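(* Fix $d\ge1$. For all partitions $\mu\subseteq\lambda$ with $\ell(\lambda)\le d$ (set $\lambda_i=0$ for $i>\ell(\lambda)$), as an identity of rational functions in $\beta$, $$\sum_{T\in\operatorname{SIT}(\lambda/\mu)}\ \prod_{k=1}^{m(T)}\left(\left[\prod_{i=1}^d\frac{1+\beta\big(\nu_i(T_{<k})+d-i+1\big)}{1+\beta(\lambda_i+d-i+1)}\right]-1\right)^{-1}\;=\;\sum_{D\in\mathcal D(\lambda/\mu)}(-\beta)^{|D|-|\lambda|}\prod_{(i,j)\in\lambda\setminus D}\frac{\beta(\lambda_i+d-i+1)+1}{h(i,j)}.$$
   Context: Partitions are identified with Young diagrams $\{(i,j):1\le j\le\lambda_i\}$ (English convention, $i$ row, $j$ column); $\lambda'$ is the conjugate, $h(i,j)=\lambda_i-j+\lambda'_j-i+1$ the hook length in $\lambda$, and $|\cdot|$ the number of cells. A standard increasing tableau of skew shape $\lambda/\mu$ is a filling $T$ of the cells of $\lambda/\mu$ by positive integers, strictly increasing along rows and down columns, whose set of entries is exactly $\{1,\dots,m\}$ for some $m=m(T)$; $\operatorname{SIT}(\lambda/\mu)$ is their set. For $k\ge1$, $\nu(T_{<k})$ is the partition whose diagram is $\mu$ together with the cells of $\lambda/\mu$ with entry $<k$; $\nu_i(T_{<k})$ is its $i$-th part. Generalized excited diagrams: for a set $S\subseteq\lambda$ of cells, a cell $(i,j)\in S$ is active if $(i+1,j),(i,j+1),(i+1,j+1)$ all lie in $\lambda\setminus S$. For active $u=(i,j)$, the type I move replaces $(i,j)$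 by $(i+1,j+1)$ in $S$, and the type II move adds $(i+1,j+1)$ to $S$ (keeping $(i,j)$). $\mathcal D(\lambda/\mu)$ is the set of all subsets of $\lambda$ obtainable from the diagram of $\mu$ by finite sequences of moves of types I and II. *)

theory Defs
  imports Main "HOL-Computational_Algebra.Polynomial" "HOL-Computational_Algebra.Fraction_Field"
begin

(* Partitions are functions lam :: nat => nat, read 1-based: lam i is the i-th part
   (i >= 1); parts beyond the length are 0. The value at index 0 is irrelevant. *)
definition is_partition :: "(nat \<Rightarrow> nat) \<Rightarrow> bool" where
  "is_partition lam \<longleftrightarrow> (\<forall>i\<ge>1. lam (Suc i) \<le> lam i) \<and> finite {i. i \<ge> 1 \<and> lam i \<noteq> 0}"

definition diagram :: "(nat \<Rightarrow> nat) \<Rightarrow> (nat \<times> nat) set" where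
  "diagram lam = {(i, j). 1 \<le> i \<and> 1 \<le> j \<and> j \<le> lam i}"

definition skew :: "(nat \<Rightarrow> nat) \<Rightarrow> (nat \<Rightarrow> nat) \<Rightarrow> (nat \<times> nat) set" where
  "skew lam mu = diagram lam - diagram mu"

definition conj_part :: "(nat \<Rightarrow> nat) \<Rightarrow> nat \<Rightarrow> nat" where
  "conj_part lam j = card {i. 1 \<le> i \<and> j \<le> lam i}"

definition hook :: "(nat \<Rightarrow> nat) \<Rightarrow> nat \<times> nat \<Rightarrow> int" where
  "hook lam c = (case c of (i, j) \<Rightarrow>
     int (lam i) - int j + int (conj_part lam j) - int i + 1)"

definition SIT :: "(nat \<Rightarrow> nat) \<Rightarrow> (nat \<Rightarrow> nat) \<Rightarrow> (nat \<times> nat \<Rightarrow> nat) set" where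
  "SIT lam mu = {T. (\<forall>c. c \<notin> skew lam mu \<longrightarrow> T c = 0)
      \<and> (\<forall>c\<in>skew lam mu. T c \<ge> 1)
      \<and> (\<forall>i j j'. (i, j) \<in> skew lam mu \<longrightarrow> (i, j') \<in> skew lam mu \<longrightarrow> j < j' \<longrightarrow> T (i, j) < T (i, j'))
      \<and> (\<forall>i i' j. (i, j) \<in> skew lam mu \<longrightarrow> (i', j) \<in> skew lam mu \<longrightarrow> i < i' \<longrightarrow> T (i, j) < T (i', j))
      \<and> (\<exists>m. T ` skew lam mu = {1..m})}"

(* m(T): the largest entry, i.e. the number of distinct entries *)
definition sit_m :: "(nat \<Rightarrow> nat) \<Rightarrow> (nat \<Rightarrow> nat) \<Rightarrow> (nat \<times> nat \<Rightarrow> nat) \<Rightarrow> nat" where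
  "sit_m lam mu T = card (T ` skew lam mu)"

definition nu_part :: "(nat \<Rightarrow> nat) \<Rightarrow> (nat \<Rightarrow> nat) \<Rightarrow> (nat \<times> nat \<Rightarrow> nat) \<Rightarrow> nat \<Rightarrow> nat \<Rightarrow> nat" where
  "nu_part lam mu T k i = card {j. (i, j) \<in> diagram mu \<union> {c \<in> skew lam mu. T c < k}}"

definition active :: "(nat \<Rightarrow> nat) \<Rightarrow> (nat \<times> nat) set \<Rightarrow> nat \<times> nat \<Rightarrow> bool" where
  "active lam S u = (case u of (i, j) \<Rightarrow> u \<in> S \<and>
     (Suc i, j) \<in> diagram lam - S \<and> (i, Suc j) \<in> diagram lam - S \<and> (Suc i, Suc j) \<in> diagram lam - S)"

inductive_set excited :: "(nat \<Rightarrow> nat) \<Rightarrow> (nat \<Rightarrow> nat) \<Rightarrow> (nat \<times> nat) set set"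
  for lam mu where
  base: "diagram mu \<in> excited lam mu"
| move1: "S \<in> excited lam mu \<Longrightarrow> active lam S (i, j) \<Longrightarrow>
          insert (Suc i, Suc j) (S - {(i, j)}) \<in> excited lam mu"
| move2: "S \<in> excited lam mu \<Longrightarrow> active lam S (i, j) \<Longrightarrow>
          insert (Suc i, Suc j) S \<in> excited lam mu"

type_synonym ratfun = "rat poly fract"

definition beta :: ratfun where
  "beta = Fract [:0, 1:] 1"

end

theory Submission
  imports Defs
begin

text \<open>Put \<open>z p = 1 + \<beta> (p + d + 1)\<close>, \<open>a i = \<lambda>\<^sub>i - i\<close> and \<open>b j = j - \<lambda>'\<^sub>j - 1\<close>. Since the hook length
  of \<open>(i, j)\<close> is \<open>a i - b j\<close>, the right-hand side is \<open>G \<mu> / G \<lambda>\<close>, where \<open>G \<mu>\<close> is the sum over the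
  generalized excited diagrams \<open>D\<close> of the products over \<open>D\<close> of \<open>z (b j) / z (a i) - 1\<close>.
  Classifying the cells with entry 1 shows that the left-hand side is the solution, equal to 1
  at \<open>\<mu> = \<lambda>\<close>, of the recursion saying that the sum of \<open>G \<nu>\<close> over all \<open>\<nu>\<close> obtained from \<open>\<mu>\<close> by
  adding a set of corners is \<open>G \<mu>\<close> times the product of the \<open>z (\<mu>\<^sub>i - i) / z (\<lambda>\<^sub>i - i)\<close>.
  For arbitrary nonzero parameters \<open>z\<close>, the function \<open>G\<close> satisfies this Chevalley formula by
  induction on \<open>\<lambda>\<close>: a corner \<open>c\<close> of \<open>\<lambda>\<close> of content \<open>k\<close> contributes only if \<open>\<mu>\<close> has a removable
  corner of content \<open>k\<close>, and deleting \<open>c\<close> exchanges \<open>z (k - 1)\<close> and \<open>z k\<close>.\<close>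

section \<open>Young diagrams as sets of cells\<close>

definition young :: "(nat \<times> nat) set \<Rightarrow> bool" where
  "young M \<longleftrightarrow> finite M \<and> (\<forall>i j. (i, j) \<in> M \<longrightarrow> 1 \<le> i \<and> 1 \<le> j) \<and>
    (\<forall>i j i' j'. (i, j) \<in> M \<longrightarrow> 1 \<le> i' \<longrightarrow> i' \<le> i \<longrightarrow> 1 \<le> j' \<longrightarrow> j' \<le> j \<longrightarrow> (i', j') \<in> M)"

definition addables :: "(nat \<times> nat) set \<Rightarrow> (nat \<times> nat) set" where
  "addables M = {c. c \<notin> M \<and> young (insert c M)}"

text \<open>This is the content of a cell, the invariant preserved by every excited move.\<close>

definition diagonal :: "nat \<times> nat \<Rightarrow> int" where
  "diagonal c = int (snd c) - int (fst c)"

lemma youngD: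
  assumes "young M"
  shows "finite M" "(i, j) \<in> M \<Longrightarrow> 1 \<le> i" "(i, j) \<in> M \<Longrightarrow> 1 \<le> j"
    "(i, j) \<in> M \<Longrightarrow> 1 \<le> i' \<Longrightarrow> i' \<le> i \<Longrightarrow> 1 \<le> j' \<Longrightarrow> j' \<le> j \<Longrightarrow> (i', j') \<in> M"
  using assms unfolding young_def by blast+

lemma young_Int: "young M \<Longrightarrow> young N \<Longrightarrow> young (M \<inter> N)"
  unfolding young_def by (intro conjI finite_Int; blast)

lemma youngI:
  assumes "finite M" "\<And>i j. (i, j) \<in> M \<Longrightarrow> 1 \<le> i \<and> 1 \<le> j"
    and "\<And>i j i' j'. (i, j) \<in> M \<Longrightarrow> 1 \<le> i' \<Longrightarrow> i' \<le> i \<Longrightarrow> 1 \<le> j' \<Longrightarrow> j' \<le> j \<Longrightarrow> (i', j') \<in> M"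
  shows "young M"
  using assms unfolding young_def by blast

lemma young_remove:
  assumes "young M" "(Suc i, j) \<notin> M" "(i, Suc j) \<notin> M"
  shows "young (M - {(i, j)})"
proof (rule youngI)
  show "finite (M - {(i, j)})" using youngD(1)[OF assms(1)] by simp
  show "1 \<le> a \<and> 1 \<le> b" if "(a, b) \<in> M - {(i, j)}" for a b
    using that youngD(2,3)[OF assms(1)] by blast
  fix a b a' b'
  assume h: "(a, b) \<in> M - {(i, j)}" "1 \<le> a'" "a' \<le> a" "1 \<le> b'" "b' \<le> b"
  have "(a', b') \<noteq> (i, j)"
  proof
    assume e: "(a', b') = (i, j)"
    have "i \<le> a" "j \<le> b" "(a, b) \<noteq> (i, j)" using e h by auto
    then consider "Suc i \<le> a" | "Suc j \<le> b" by fastforce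
    then show False
    proof cases
      case 1
      then show False using youngD(4)[OF assms(1), of a b "Suc i" j] h e assms(2) by auto
    next
      case 2
      then show False using youngD(4)[OF assms(1), of a b i "Suc j"] h e assms(3) by auto
    qed
  qed
  moreover have "(a', b') \<in> M" using youngD(4)[OF assms(1), of a b a' b'] h by blast
  ultimately show "(a', b') \<in> M - {(i, j)}" by blast
qed

lemma removable_neighbours:
  assumes "young (M - {(i, j)})" "(i, j) \<in> M" "young M" "(i', j') \<noteq> (i, j)" "i \<le> i'" "j \<le> j'"
  shows "(i', j') \<notin> M"
  using youngD(4)[OF assms(1), of i' j' i j] youngD(2,3)[OF assms(3,2)] assms by auto

lemma addable_below:
  assumes "(i, j) \<in> addables M" "(i', j') \<noteq> (i, j)" "1 \<le> i'" "i' \<le> i" "1 \<le> j'" "j' \<le> j"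
  shows "(i', j') \<in> M"
  using assms unfolding addables_def by (auto dest: youngD(4)[of _ i j i' j'])

lemma addable_pos: "(i, j) \<in> addables M \<Longrightarrow> 1 \<le> i \<and> 1 \<le> j"
  using youngD(2,3)[of "insert (i, j) M" i j] unfolding addables_def by simp

lemma addableI:
  assumes "young M" "(i, j) \<notin> M" "1 \<le> i" "1 \<le> j"
    "\<And>i' j'. (i', j') \<noteq> (i, j) \<Longrightarrow> 1 \<le> i' \<Longrightarrow> i' \<le> i \<Longrightarrow> 1 \<le> j' \<Longrightarrow> j' \<le> j \<Longrightarrow> (i', j') \<in> M"
  shows "(i, j) \<in> addables M"
proof -
  have "young (insert (i, j) M)"
  proof (rule youngI)
    show "finite (insert (i, j) M)" using youngD(1)[OF assms(1)] by simp
    show "1 \<le> a \<and> 1 \<le> b" if "(a, b) \<in> insert (i, j) M" for a b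
      using that youngD(2,3)[OF assms(1)] assms(3,4) by blast
    fix a b a' b'
    assume h: "(a, b) \<in> insert (i, j) M" "1 \<le> a'" "a' \<le> a" "1 \<le> b'" "b' \<le> b"
    show "(a', b') \<in> insert (i, j) M"
    proof (cases "(a, b) = (i, j)")
      case True
      then show ?thesis using assms(5)[of a' b'] h by blast
    next
      case False
      then show ?thesis using youngD(4)[OF assms(1), of a b a' b'] h by blast
    qed
  qed
  then show ?thesis using assms(2) unfolding addables_def by simp
qed

lemma addables_finite:
  assumes "young M" shows "finite (addables M)"
proof (rule finite_subset)
  show "addables M \<subseteq> {(1, 1)} \<union> (\<lambda>(i, j). (Suc i, j)) ` M \<union> (\<lambda>(i, j). (i, Suc j)) ` M"
  proof
    fix c assume c: "c \<in> addables M"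
    obtain i j where ij: "c = (i, j)" by force
    have p: "1 \<le> i" "1 \<le> j" using addable_pos c ij by auto
    consider "i = 1" "j = 1" | "i > 1" | "j > 1" using p by linarith
    then show "c \<in> {(1, 1)} \<union> (\<lambda>(i, j). (Suc i, j)) ` M \<union> (\<lambda>(i, j). (i, Suc j)) ` M"
    proof cases
      case 1 then show ?thesis using ij by simp
    next
      case 2
      then have "(i - 1, j) \<in> M" using addable_below[of i j M "i - 1" j] c ij p by auto
      then show ?thesis using ij 2 by force
    next
      case 3
      then have "(i, j - 1) \<in> M" using addable_below[of i j M i "j - 1"] c ij p by auto
      then show ?thesis using ij 3 by force
    qed
  qed
  show "finite ({(1, 1)} \<union> (\<lambda>(i, j). (Suc i, j)) ` M \<union> (\<lambda>(i, j). (i, Suc j)) ` M)"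
    using youngD(1)[OF assms] by simp
qed

text \<open>The closure condition starts from a single cell, and each cell of
  \<open>M \<union> A\<close> already lies in a Young diagram inside that union, namely
  \<open>M\<close> or \<open>insert c M\<close>.\<close>

lemma young_Un_addables:
  assumes "young M" "A \<subseteq> addables M"
  shows "young (M \<union> A)"
proof (rule youngI)
  show "finite (M \<union> A)"
    using finite_subset[OF assms(2) addables_finite[OF assms(1)]] youngD(1)[OF assms(1)] by simp
  have *: "\<exists>N. young N \<and> c \<in> N \<and> N \<subseteq> M \<union> A" if "c \<in> M \<union> A" for c
  proof (cases "c \<in> M")
    case False
    then have "young (insert c M)" "insert c M \<subseteq> M \<union> A" using that assms(2) unfolding addables_def by auto
    then show ?thesis by blast
  qed (use assms(1) in blast)
  show "1 \<le> i \<and> 1 \<le> j" if "(i, j) \<in> M \<union> A" for i j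
    using *[OF that] youngD(2,3) by blast
  show "(i', j') \<in> M \<union> A"
    if "(i, j) \<in> M \<union> A" "1 \<le> i'" "i' \<le> i" "1 \<le> j'" "j' \<le> j" for i j i' j'
    using *[OF that(1)] youngD(4)[OF _ _ that(2-5)] by blast
qed

lemma addables_mono:
  assumes "young M" "A \<subseteq> addables M" "c \<notin> A" "c \<in> addables M"
  shows "c \<in> addables (M \<union> A)"
proof -
  have "young (M \<union> insert c A)" using young_Un_addables assms by (metis insert_subset)
  then show ?thesis using assms(3,4) unfolding addables_def by auto
qed

section \<open>Corners on a common diagonal\<close>

lemma same_diagonal:
  assumes "diagonal (i, j) = diagonal (i', j')" "i \<le> i'"
  obtains t where "i' = i + t" "j' = j + t"
proof
  show "i' = i + (i' - i)" "j' = j + (i' - i)" using assms unfolding diagonal_def by auto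
qed

text \<open>Two cells of one diagonal are comparable in both coordinates, so the earlier of two
  distinct addable cells would already belong to \<open>M\<close>.\<close>

lemma addable_unique:
  assumes "c \<in> addables M" "e \<in> addables M" "diagonal c = diagonal e"
  shows "c = e"
proof -
  have *: "c = e" if h: "c \<in> addables M" "e \<in> addables M" "diagonal c = diagonal e" "fst c \<le> fst e" for c e
  proof -
    obtain i j i' j' where e: "c = (i, j)" "e = (i', j')" by force
    obtain t where t: "i' = i + t" "j' = j + t" using same_diagonal[of i j i' j'] h e by auto
    have "c \<notin> M" using h unfolding addables_def by auto
    then show ?thesis using addable_below[of i' j' M i j] addable_pos[of i j M] h e t by auto
  qed
  show ?thesis using *[of c e] *[of e c] assms by (metis nat_le_linear)
qed

lemma removable_unique:
  assumes "c \<in> M" "e \<in> M" "young (M - {c})" "young (M - {e})" "diagonal c = diagonal e" "young M"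
  shows "c = e"
proof -
  have *: "c = e" if h: "c \<in> M" "e \<in> M" "young (M - {c})" "diagonal c = diagonal e" "fst c \<le> fst e" for c e
  proof -
    obtain i j i' j' where e: "c = (i, j)" "e = (i', j')" by force
    obtain t where t: "i' = i + t" "j' = j + t" using same_diagonal[of i j i' j'] h e by auto
    then show ?thesis using removable_neighbours[of M i j i' j'] h e assms(6) by auto
  qed
  show ?thesis using *[of c e] *[of e c] assms by (metis nat_le_linear)
qed

text \<open>If \<open>c\<close> does not come after \<open>e\<close> on the diagonal, closure below
  \<open>e\<close> puts \<open>c\<close> into \<open>M\<close>. If it comes after, the right
  neighbour of \<open>e\<close> lies in \<open>M\<close> and blocks the removal of
  \<open>e\<close>.\<close>

lemma addable_not_removable:
  assumes "young M" "c \<in> addables M" "e \<in> M" "young (M - {e})"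
  shows "diagonal c \<noteq> diagonal e"
proof
  assume d: "diagonal c = diagonal e"
  obtain i j i' j' where e: "c = (i, j)" "e = (i', j')" by force
  have cM: "c \<notin> M" using assms(2) unfolding addables_def by auto
  show False
  proof (cases "i \<le> i'")
    case True
    then obtain t where t: "i' = i + t" "j' = j + t" using same_diagonal[of i j i' j'] d e by auto
    then show False using youngD(4)[OF assms(1), of i' j' i j] addable_pos[of i j M] assms e cM by auto
  next
    case False
    then obtain t where t: "i = i' + t" "j = j' + t" using same_diagonal[of i' j' i j] d e by auto
    have "t \<ge> 1" using False t by auto
    then have "(i', Suc j') \<in> M"
      using addable_below[of i j M i' "Suc j'"] youngD(2)[OF assms(1), of i' j'] assms e t by auto
    then show False using removable_neighbours[of M i' j' i' "Suc j'"] assms e by auto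
  qed
qed

text \<open>A cell that maximises the sum of its coordinates is removable, so every diagram can be
  built corner by corner.\<close>

lemma young_induct [consumes 1, case_names empty insert]:
  assumes "young L" "P {}"
    and step: "\<And>L c. young L \<Longrightarrow> c \<in> addables L \<Longrightarrow> P L \<Longrightarrow> P (insert c L)"
  shows "P L"
  using assms(1)
proof (induction "card L" arbitrary: L)
  case 0
  then show ?case using youngD(1) assms(2) by force
next
  case (Suc n)
  then have fin: "finite L" and ne: "L \<noteq> {}" using youngD(1) by force+
  obtain c where c: "c \<in> L" "\<forall>e\<in>L. fst e + snd e \<le> fst c + snd c"
  proof -
    have "Max ((\<lambda>e. fst e + snd e) ` L) \<in> (\<lambda>e. fst e + snd e) ` L" using fin ne by simp
    then obtain c where c: "c \<in> L" "Max ((\<lambda>e. fst e + snd e) ` L) = fst c + snd c" by (rule imageE)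
    have "fst e + snd e \<le> fst c + snd c" if "e \<in> L" for e
      unfolding c(2)[symmetric] using fin that by (intro Max_ge) auto
    then show ?thesis using that c(1) by blast
  qed
  obtain i j where ij: "c = (i, j)" by force
  have y: "young (L - {c})"
    unfolding ij
  proof (rule young_remove[OF Suc(3)])
    show "(Suc i, j) \<notin> L" "(i, Suc j) \<notin> L" using c(2) ij by fastforce+
  qed
  have "insert c (L - {c}) = L" using c(1) by blast
  then have "c \<in> addables (L - {c})" using Suc(3) unfolding addables_def by simp
  moreover have "n = card (L - {c})" using Suc(2) c fin by simp
  ultimately have "P (insert c (L - {c}))" using Suc(1) y step by blast
  then show ?case using c by (simp add: insert_absorb)
qed

section \<open>Generalized excited diagrams\<close>

definition act :: "(nat \<times> nat) set \<Rightarrow> (nat \<times> nat) set \<Rightarrow> nat \<Rightarrow> nat \<Rightarrow> bool" where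
  "act L S i j \<longleftrightarrow> (i, j) \<in> S \<and> (Suc i, j) \<in> L - S \<and> (i, Suc j) \<in> L - S \<and> (Suc i, Suc j) \<in> L - S"

text \<open>Unlike in \<open>excited\<close>, starting requires \<open>M \<subseteq> L\<close>. The
  set is therefore empty for any other \<open>M\<close>, and sums over added corners need not record
  whether these stay inside \<open>L\<close>.\<close>

inductive_set exc :: "(nat \<times> nat) set \<Rightarrow> (nat \<times> nat) set \<Rightarrow> (nat \<times> nat) set set" for L M where
  start: "M \<subseteq> L \<Longrightarrow> M \<in> exc L M"
| slide: "S \<in> exc L M \<Longrightarrow> act L S i j \<Longrightarrow> insert (Suc i, Suc j) (S - {(i, j)}) \<in> exc L M"
| grow: "S \<in> exc L M \<Longrightarrow> act L S i j \<Longrightarrow> insert (Suc i, Suc j) S \<in> exc L M"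

lemma exc_subset:
  assumes "S \<in> exc L M" shows "S \<subseteq> L \<and> M \<subseteq> L"
  using assms by induction (auto simp: act_def)

lemma exc_empty: "\<not> M \<subseteq> L \<Longrightarrow> exc L M = {}"
  using exc_subset by blast

lemma finite_exc: "finite L \<Longrightarrow> finite (exc L M)"
  using exc_subset by (meson Pow_iff finite_Pow_iff finite_subset subsetI)

lemma exc_self: "exc L L = {L}"
proof -
  have "S = L" if "S \<in> exc L L" for S
    using that by induction (auto simp: act_def)
  then show ?thesis using exc.start[of L L] by blast
qed

text \<open>If no cell of \<open>S\<close> on the diagonal of \<open>u\<close> or on the two neighbouring diagonals lies
  beyond \<open>u\<close>, then \<open>u\<close> is a final copy of a removable corner of \<open>M\<close>.\<close>

lemma exc_remove_last:
  assumes "S \<in> exc L M" "young M" "(i, j) \<in> S"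
    and "\<And>t. (Suc (i + t), j + t) \<notin> S \<and> (i + t, Suc (j + t)) \<notin> S \<and> (Suc (i + t), Suc (j + t)) \<notin> S"
  shows "\<exists>e\<in>M. young (M - {e}) \<and> diagonal e = diagonal (i, j) \<and>
    (S - {(i, j)} \<in> exc L M \<or> S - {(i, j)} \<in> exc L (M - {e}))"
  using assms(1,3,4)
proof (induction arbitrary: i j)
  case start
  have "young (M - {(i, j)})"
    using start(3)[of 0] assms(2) by (intro young_remove) auto
  moreover have "M - {(i, j)} \<in> exc L (M - {(i, j)})" using start(1) by (intro exc.start) auto
  ultimately show ?case using start(2) by blast
next
  case (slide S p q)
  show ?case
  proof (cases "(Suc p, Suc q) = (i, j)")
    case True
    \<comment> \<open>The move has just created \<open>(i, j)\<close>. Before it,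
      \<open>(p, q)\<close> was the last cell, and deleting \<open>(i, j)\<close> afterwards amounts
      to deleting \<open>(p, q)\<close> before, so the induction hypothesis applies at
      \<open>(p, q)\<close>.\<close>
    have t: "(Suc (p + t), q + t) \<notin> S \<and> (p + t, Suc (q + t)) \<notin> S \<and> (Suc (p + t), Suc (q + t)) \<notin> S" for t
    proof (cases t)
      case 0 then show ?thesis using slide(2) unfolding act_def by auto
    next
      case (Suc s) then show ?thesis using slide(5)[of s] True by auto
    qed
    have "diagonal (p, q) = diagonal (i, j)" using True unfolding diagonal_def by auto
    moreover have "insert (Suc p, Suc q) (S - {(p, q)}) - {(i, j)} = S - {(p, q)}"
      using True slide(2) unfolding act_def by auto
    ultimately show ?thesis using slide(3)[OF _ t] slide(2) unfolding act_def by simp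
  next
    case False
    have u: "(i, j) \<in> S" "(i, j) \<noteq> (p, q)" using slide(4) False by auto
    \<comment> \<open>A cell that leaves \<open>S\<close> in a slide reappears one step further on
      its diagonal; if both places are empty afterwards, the first was empty before.\<close>
    have key: "(a, b) \<notin> S"
      if "(a, b) \<notin> insert (Suc p, Suc q) (S - {(p, q)})"
        "(Suc a, Suc b) \<notin> insert (Suc p, Suc q) (S - {(p, q)})" for a b
      using that by auto
    have t: "(Suc (i + t), j + t) \<notin> S \<and> (i + t, Suc (j + t)) \<notin> S \<and> (Suc (i + t), Suc (j + t)) \<notin> S" for t
      using key slide(5)[of t] slide(5)[of "Suc t", unfolded add_Suc_right] by blast
    \<comment> \<open>The move does not involve \<open>(i, j)\<close> and so commutes with its
      deletion. The inner shape \<open>N\<close> below stays arbitrary in order to serve both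
      alternatives of the conclusion.\<close>
    have "act L (S - {(i, j)}) p q" using slide(2) u unfolding act_def by auto
    then have "S - {(i, j)} \<in> exc L N \<Longrightarrow>
        insert (Suc p, Suc q) (S - {(i, j)} - {(p, q)}) \<in> exc L N" for N
      by (intro exc.slide)
    moreover have "insert (Suc p, Suc q) (S - {(i, j)} - {(p, q)}) = insert (Suc p, Suc q) (S - {(p, q)}) - {(i, j)}"
      using False by auto
    ultimately show ?thesis using slide(3)[OF u(1) t] by metis
  qed
next
  case (grow S p q)
  show ?case
  proof (cases "(Suc p, Suc q) = (i, j)")
    case True
    have t: "(Suc (p + t), q + t) \<notin> S \<and> (p + t, Suc (q + t)) \<notin> S \<and> (Suc (p + t), Suc (q + t)) \<notin> S" for t
    proof (cases t)
      case 0 then show ?thesis using grow(2) unfolding act_def by auto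
    next
      case (Suc s) then show ?thesis using grow(5)[of s] True by auto
    qed
    have "diagonal (p, q) = diagonal (i, j)" using True unfolding diagonal_def by auto
    \<comment> \<open>Deleting the copy undoes a type II move and leaves a diagram of
      \<open>M\<close> itself; the induction hypothesis only supplies \<open>e\<close>.\<close>
    moreover have "insert (Suc p, Suc q) S - {(i, j)} = S"
      using True grow(2) unfolding act_def by auto
    ultimately show ?thesis using grow(3)[OF _ t] grow(1,2) unfolding act_def by auto
  next
    case False
    have u: "(i, j) \<in> S" "(i, j) \<noteq> (p, q)" using grow(4) grow(5)[of 0] False by auto
    have t: "(Suc (i + t), j + t) \<notin> S \<and> (i + t, Suc (j + t)) \<notin> S \<and> (Suc (i + t), Suc (j + t)) \<notin> S" for t
      using grow(5)[of t] by auto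
    have "act L (S - {(i, j)}) p q" using grow(2) u unfolding act_def by auto
    then have "S - {(i, j)} \<in> exc L N \<Longrightarrow> insert (Suc p, Suc q) (S - {(i, j)}) \<in> exc L N" for N
      by (intro exc.grow)
    moreover have "insert (Suc p, Suc q) (S - {(i, j)}) = insert (Suc p, Suc q) S - {(i, j)}"
      using False by auto
    ultimately show ?thesis using grow(3)[OF u(1) t] by metis
  qed
qed

text \<open>When the diagonal ahead and its two neighbours are free of \<open>S\<close>, repeated
  type I moves carry the cell as far as \<open>L\<close> reaches, leaving nothing behind.\<close>

lemma exc_slide_far:
  assumes "insert (i, j) S \<in> exc L M" "young L" "(i, j) \<notin> S" "1 \<le> i" "1 \<le> j"
    and far: "\<And>t. (Suc (i + t), j + t) \<notin> S \<and> (i + t, Suc (j + t)) \<notin> S \<and> (Suc (i + t), Suc (j + t)) \<notin> S"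
    and "(i + t, j + t) \<in> L"
  shows "insert (i + t, j + t) S \<in> exc L M"
  using assms(7)
proof (induction t)
  case 0
  then show ?case using assms(1) by simp
next
  case (Suc t)
  have L: "(Suc (i + t), j + t) \<in> L" "(i + t, Suc (j + t)) \<in> L" "(i + t, j + t) \<in> L"
    using youngD(4)[OF assms(2) Suc(2)] assms(4,5) by auto
  have "act L (insert (i + t, j + t) S) (i + t) (j + t)"
    unfolding act_def using L Suc(2) far[of t] by auto
  moreover have "(i + t, j + t) \<notin> S" using far[of "t - 1"] assms(3) by (cases t) auto
  ultimately show ?case using exc.slide[OF Suc(1)[OF L(3)], of "i + t" "j + t"] by simp
qed

text \<open>Since \<open>c\<close> lies outside \<open>L\<close>, the moves inside \<open>L\<close>
  never meet it. A cell can thus be parked on \<open>c\<close> first and all remaining moves made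
  afterwards.\<close>

lemma exc_carry:
  assumes "S \<in> exc L N" "c \<notin> L" "insert c N \<in> exc (insert c L) M"
  shows "insert c S \<in> exc (insert c L) M"
  using assms(1)
proof induction
  case start
  then show ?case using assms(3) by simp
next
  case (slide S i j)
  have "act (insert c L) (insert c S) i j" using slide(2) assms(2) unfolding act_def by auto
  note * = exc.slide[OF slide(3) this]
  have "c \<noteq> (i, j)" using slide(1,2) exc_subset assms(2) unfolding act_def by blast
  then show ?case using * by (simp add: insert_Diff_if insert_commute)
next
  case (grow S i j)
  have "act (insert c L) (insert c S) i j" using grow(2) assms(2) unfolding act_def by auto
  from exc.grow[OF grow(3) this] show ?case by (simp add: insert_commute)
qed

lemma exc_mono:
  assumes "S \<in> exc L M" "L \<subseteq> L'"
  shows "S \<in> exc L' M"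
  using assms(1)
proof induction
  case start
  then show ?case using assms(2) by (intro exc.start) auto
next
  case (slide S i j)
  then show ?case using assms(2) by (intro exc.slide) (auto simp: act_def)
next
  case (grow S i j)
  then show ?case using assms(2) by (intro exc.grow) (auto simp: act_def)
qed

text \<open>Nothing lies beyond the corner \<open>c\<close>, so it can be entered but never left.
  Before that, all moves take place in \<open>L\<close>; the cell that enters \<open>c\<close> is
  the last one in the sense of \<open>exc_remove_last\<close>, which provides
  \<open>e\<close>.\<close>

lemma exc_insert_dest:
  assumes "young L" "c \<in> addables L" "young M" "D \<in> exc (insert c L) M"
  shows "(c \<notin> D \<longrightarrow> D \<in> exc L M) \<and>
    (c \<in> D \<longrightarrow> (\<exists>e\<in>M. young (M - {e}) \<and> diagonal e = diagonal c \<and>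
      (D - {c} \<in> exc L M \<or> D - {c} \<in> exc L (M - {e}))))"
proof -
  obtain a b where ab: "c = (a, b)" by force
  have yc: "young (insert c L)" and cL: "c \<notin> L" using assms(2) unfolding addables_def by auto
  have beyond: "(a', b') \<notin> insert c L" if "a \<le> a'" "b \<le> b'" "(a', b') \<noteq> c" for a' b'
    using youngD(4)[OF assms(1), of a' b' a b] addable_pos[of a b L] assms(2) that ab cL by auto
  have last: "\<exists>e\<in>M. young (M - {e}) \<and> diagonal e = diagonal c \<and>
      (S - {(i, j)} \<in> exc L M \<or> S - {(i, j)} \<in> exc L (M - {e}))"
    if S: "S \<in> exc L M" and A: "act (insert c L) S i j" and ij: "(Suc i, Suc j) = c" for S i j
  proof -
    have "(Suc (i + t), j + t) \<notin> S \<and> (i + t, Suc (j + t)) \<notin> S \<and> (Suc (i + t), Suc (j + t)) \<notin> S" for t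
    proof (cases t)
      case 0 then show ?thesis using A unfolding act_def by auto
    next
      case (Suc s)
      then show ?thesis
        using beyond[of "Suc (i + t)" "j + t"] beyond[of "i + t" "Suc (j + t)"]
          beyond[of "Suc (i + t)" "Suc (j + t)"] exc_subset[OF S] ij ab by auto
    qed
    moreover have "diagonal (i, j) = diagonal c" using ij unfolding diagonal_def by auto
    ultimately show ?thesis
      using exc_remove_last[OF S assms(3), of i j] A unfolding act_def by simp
  qed
  \<comment> \<open>Each equality would put the cell \<open>(Suc i, Suc j)\<close> of the shape
    beyond the corner \<open>c\<close>. Hence \<open>c\<close> takes part in a move only as its
    target.\<close>
  have next_ne: "c \<noteq> (i, j)" "c \<noteq> (Suc i, j)" "c \<noteq> (i, Suc j)"
    if "act (insert c L) S i j" for S i j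
    using that beyond[of "Suc i" "Suc j"] ab unfolding act_def by auto
  show ?thesis
    using assms(4)
  proof induction
    case start
    show ?case
    proof (cases "c \<in> M")
      case True
      have "young (M - {c})"
        unfolding ab using beyond[of "Suc a" b] beyond[of a "Suc b"] start ab assms(3)
        by (intro young_remove) auto
      moreover have "M - {c} \<in> exc L (M - {c})" using start by (intro exc.start) auto
      ultimately show ?thesis using True by blast
    next
      case False
      then show ?thesis using start by (auto intro: exc.start)
    qed
  next
    case (slide S i j)
    note ne = next_ne[OF slide(2)]
    consider "c \<in> S" | "c \<notin> S" "(Suc i, Suc j) = c" | "c \<notin> S" "(Suc i, Suc j) \<noteq> c" by blast
    then show ?case
    proof cases
      case 1
      have A: "act L (S - {c}) i j" using slide(2) ne 1 unfolding act_def by auto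
      have "S - {c} \<in> exc L N \<Longrightarrow> insert (Suc i, Suc j) (S - {c} - {(i, j)}) \<in> exc L N" for N
        using A by (intro exc.slide)
      moreover have "(Suc i, Suc j) \<noteq> c" using slide(2) 1 unfolding act_def by auto
      then have "insert (Suc i, Suc j) (S - {c} - {(i, j)}) = insert (Suc i, Suc j) (S - {(i, j)}) - {c}" by auto
      ultimately show ?thesis using slide(3) 1 ne by (metis DiffI insertCI singletonD)
    next
      case 2
      then have "insert (Suc i, Suc j) (S - {(i, j)}) - {c} = S - {(i, j)}" by auto
      then show ?thesis using last[of S i j] slide 2 by auto
    next
      case 3
      have "act L S i j" using slide(2) ne 3 unfolding act_def by auto
      then show ?thesis using 3 slide(3) by (auto intro: exc.slide)
    qed
  next
    case (grow S i j)
    note ne = next_ne[OF grow(2)]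
    consider "c \<in> S" | "c \<notin> S" "(Suc i, Suc j) = c" | "c \<notin> S" "(Suc i, Suc j) \<noteq> c" by blast
    then show ?case
    proof cases
      case 1
      have A: "act L (S - {c}) i j" using grow(2) ne 1 unfolding act_def by auto
      have "S - {c} \<in> exc L N \<Longrightarrow> insert (Suc i, Suc j) (S - {c}) \<in> exc L N" for N
        using A by (intro exc.grow)
      moreover have "(Suc i, Suc j) \<noteq> c" using grow(2) 1 unfolding act_def by auto
      then have "insert (Suc i, Suc j) (S - {c}) = insert (Suc i, Suc j) S - {c}" by auto
      ultimately show ?thesis using grow(3) 1 by (metis insertCI)
    next
      case 2
      then have "insert (Suc i, Suc j) S - {c} = S" by auto
      then show ?thesis using last[of S i j] grow 2 by auto
    next
      case 3
      have "act L S i j" using grow(2) ne 3 unfolding act_def by auto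
      then show ?thesis using 3 grow(3) by (auto intro: exc.grow)
    qed
  qed
qed

text \<open>A converse to \<open>exc_insert_dest\<close>: first bring a cell to \<open>c\<close>,
  then perform the moves that produce \<open>S\<close>. If \<open>S\<close> comes from
  \<open>M - {e}\<close>, the cell \<open>e\<close> itself travels; if \<open>S\<close> comes from
  \<open>M\<close>, a type II move at \<open>e\<close> creates the travelling copy.\<close>

lemma exc_insert_intro:
  assumes "young L" "c \<in> addables L" "young M" "e \<in> M" "young (M - {e})" "diagonal e = diagonal c"
    and "S \<in> exc L M \<or> S \<in> exc L (M - {e})"
  shows "insert c S \<in> exc (insert c L) M"
proof -
  obtain a b where ab: "c = (a, b)" by force
  obtain i j where ij: "e = (i, j)" by force
  have yc: "young (insert c L)" and cL: "c \<notin> L" using assms(2) unfolding addables_def by auto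
  have pos: "1 \<le> i" "1 \<le> j" using youngD(2,3)[OF assms(3)] assms(4) ij by auto
  have sub: "M - {e} \<subseteq> L" using assms(7) exc_subset by blast
  \<comment> \<open>If \<open>c\<close> preceded \<open>e\<close> on their diagonal, closure would
    put \<open>c\<close> into \<open>M - {e}\<close> and hence into \<open>L\<close>.\<close>
  have "\<not> a < i"
  proof
    assume "a < i"
    moreover have "j - b = i - a" "b \<le> j" using assms(6) \<open>a < i\<close> ab ij unfolding diagonal_def by auto
    ultimately have "c \<in> M"
      using youngD(4)[OF assms(3), of i j a b] addable_pos[of a b L] assms(2,4) ab ij by auto
    then show False using sub cL \<open>a < i\<close> ab ij by auto
  qed
  then obtain t where t: "a = i + t" "b = j + t" using same_diagonal[of i j a b] assms(6) ab ij by auto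
  have e: "e \<in> insert c L" using youngD(4)[OF yc, of a b i j] pos t ab ij by auto
  then have M: "M \<in> exc (insert c L) M" using sub by (intro exc.start) auto
  have far: "(Suc (i + s), j + s) \<notin> M \<and> (i + s, Suc (j + s)) \<notin> M \<and> (Suc (i + s), Suc (j + s)) \<notin> M" for s
    using removable_neighbours[of M i j] assms(3,4,5) ij by auto
  show ?thesis
  proof (cases "S \<in> exc L M")
    case True
    then have "M \<subseteq> L" using exc_subset by blast
    then have "e \<noteq> c" using assms(4) cL by auto
    then obtain s where s: "t = Suc s" using t ab ij by (cases t) auto
    have L: "(Suc i, j) \<in> insert c L" "(i, Suc j) \<in> insert c L" "(Suc i, Suc j) \<in> insert c L"
      using youngD(4)[OF yc, of a b "Suc i" j] youngD(4)[OF yc, of a b i "Suc j"]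
        youngD(4)[OF yc, of a b "Suc i" "Suc j"] t s ab pos by auto
    have "act (insert c L) M i j" unfolding act_def using L assms(4) ij far[of 0] by auto
    then have "insert (Suc i, Suc j) M \<in> exc (insert c L) M" by (intro exc.grow[OF M])
    then have "insert (Suc i + s, Suc j + s) M \<in> exc (insert c L) M"
    proof (rule exc_slide_far[OF _ yc])
      show "(Suc i, Suc j) \<notin> M" using far[of 0] by simp
      show "1 \<le> Suc i" "1 \<le> Suc j" by auto
      show "(Suc (Suc i + r), Suc j + r) \<notin> M \<and> (Suc i + r, Suc (Suc j + r)) \<notin> M \<and>
          (Suc (Suc i + r), Suc (Suc j + r)) \<notin> M" for r
        using far[of "Suc r"] by simp
      show "(Suc i + s, Suc j + s) \<in> insert c L" using t s ab by simp
    qed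
    then have "insert c M \<in> exc (insert c L) M" using t s ab by simp
    then show ?thesis using exc_carry[OF True cL] by blast
  next
    case False
    then have S: "S \<in> exc L (M - {e})" using assms(7) by blast
    have "insert (i + t, j + t) (M - {e}) \<in> exc (insert c L) M"
      using yc M far t ab ij pos assms(4) by (intro exc_slide_far) (auto simp: insert_absorb)
    then have "insert c (M - {e}) \<in> exc (insert c L) M" using t ab by simp
    then show ?thesis using exc_carry[OF S cL] by blast
  qed
qed

text \<open>A generalized excited diagram determines its initial shape. Deleting \<open>c\<close>
  from \<open>D\<close> reduces to \<open>L\<close>; the mixed cases such as
  \<open>M = N - {f}\<close> fail because \<open>M\<close> would have an addable and a removable
  corner on one diagonal.\<close>

lemma exc_disjoint:
  assumes "young L" "young M" "young N" "D \<in> exc L M" "D \<in> exc L N"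
  shows "M = N"
  using assms
proof (induction arbitrary: M N D rule: young_induct)
  case empty
  then show ?case using exc_subset by blast
next
  case (insert L c)
  note dM = exc_insert_dest[OF insert(1,2,4,6)] and dN = exc_insert_dest[OF insert(1,2,5,7)]
  show ?case
  proof (cases "c \<in> D")
    case False
    then show ?thesis using dM dN insert by blast
  next
    case True
    obtain e where e: "e \<in> M" "young (M - {e})" "diagonal e = diagonal c"
      "D - {c} \<in> exc L M \<or> D - {c} \<in> exc L (M - {e})" using dM True by blast
    obtain f where f: "f \<in> N" "young (N - {f})" "diagonal f = diagonal c"
      "D - {c} \<in> exc L N \<or> D - {c} \<in> exc L (N - {f})" using dN True by blast
    have eA: "e \<in> addables (M - {e})" "f \<in> addables (N - {f})"
      using e f insert(4,5) unfolding addables_def by (auto simp: insert_absorb)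
    consider "M = N" | "M - {e} = N - {f}" | "M = N - {f}" | "M - {e} = N"
      using e(2,4) f(2,4) insert(3)[of M N] insert(3)[of M "N - {f}"] insert(3)[of "M - {e}" N]
        insert(3)[of "M - {e}" "N - {f}"] insert(4,5) by blast
    then show ?thesis
    proof cases
      case 2
      then have "e = f" using addable_unique eA e(3) f(3) by metis
      then show ?thesis using 2 e f by (metis insert_Diff)
    next
      case 3
      then show ?thesis using addable_not_removable[of M f e] eA e f insert(4) by auto
    next
      case 4
      then show ?thesis using addable_not_removable[of N e f] eA e f insert(5) by auto
    qed
  qed
qed

section \<open>Weights and the Chevalley formula\<close>

definition row_len :: "(nat \<times> nat) set \<Rightarrow> nat \<Rightarrow> nat" where
  "row_len M i = card {j. (i, j) \<in> M}"

definition col_len :: "(nat \<times> nat) set \<Rightarrow> nat \<Rightarrow> nat" where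
  "col_len M j = card {i. (i, j) \<in> M}"

text \<open>For a Young diagram and \<open>i \<ge> 1\<close> these are the bead positions of the
  Maya diagram (shifted beta-numbers); the values of \<open>col_pos\<close> at positive indices are
  the complementary positions.\<close>

definition row_pos :: "(nat \<times> nat) set \<Rightarrow> nat \<Rightarrow> int" where
  "row_pos M i = int (row_len M i) - int i"

definition col_pos :: "(nat \<times> nat) set \<Rightarrow> nat \<Rightarrow> int" where
  "col_pos M j = int j - int (col_len M j) - 1"

definition swap :: "int \<Rightarrow> int \<Rightarrow> int" where
  "swap k p = (if p = k then k - 1 else if p = k - 1 then k else p)"

definition cell_wt :: "(nat \<times> nat) set \<Rightarrow> (int \<Rightarrow> 'a::field) \<Rightarrow> nat \<times> nat \<Rightarrow> 'a" where
  "cell_wt L z c = z (col_pos L (snd c)) / z (row_pos L (fst c)) - 1"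

definition exc_sum :: "(nat \<times> nat) set \<Rightarrow> (int \<Rightarrow> 'a::field) \<Rightarrow> (nat \<times> nat) set \<Rightarrow> 'a" where
  "exc_sum L z M = (\<Sum>D\<in>exc L M. \<Prod>c\<in>D. cell_wt L z c)"

definition row_wt :: "nat \<Rightarrow> (int \<Rightarrow> 'a::field) \<Rightarrow> (nat \<times> nat) set \<Rightarrow> 'a" where
  "row_wt d z M = (\<Prod>i\<in>{1..d}. z (row_pos M i))"

lemma swap_simps [simp]: "swap k k = k - 1" "swap k (k - 1) = k" "swap k (swap k p) = p"
  unfolding swap_def by auto

section \<open>Row and column lengths, and the effect of adding a corner\<close>

lemma initial_segment:
  fixes X :: "nat set"
  assumes "finite X" "\<And>x. x \<in> X \<Longrightarrow> 1 \<le> x" "\<And>x y. x \<in> X \<Longrightarrow> 1 \<le> y \<Longrightarrow> y \<le> x \<Longrightarrow> y \<in> X"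
  shows "X = {1..card X}"
proof (cases "X = {}")
  case False
  have "X = {1..Max X}"
  proof
    show "X \<subseteq> {1..Max X}" using assms(1,2) by auto
    show "{1..Max X} \<subseteq> X" using assms(3)[OF Max_in[OF assms(1) False]] by auto
  qed
  then show ?thesis by (metis card_atLeastAtMost diff_Suc_1)
qed simp

lemma finite_line:
  assumes "young M" shows "finite {j. (i, j) \<in> M}" "finite {i. (i, j) \<in> M}"
proof -
  have "{j. (i, j) \<in> M} \<subseteq> snd ` M" "{i. (i, j) \<in> M} \<subseteq> fst ` M" by force+
  then show "finite {j. (i, j) \<in> M}" "finite {i. (i, j) \<in> M}"
    using youngD(1)[OF assms] finite_surj by blast+
qed

lemma mem_iff_row:
  assumes "young M" "1 \<le> i"
  shows "(i, j) \<in> M \<longleftrightarrow> 1 \<le> j \<and> j \<le> row_len M i"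
proof -
  have "{j. (i, j) \<in> M} = {1..card {j. (i, j) \<in> M}}"
  proof (rule initial_segment)
    show "finite {j. (i, j) \<in> M}" using finite_line[OF assms(1)] by blast
    show "1 \<le> x" if "x \<in> {j. (i, j) \<in> M}" for x using youngD(3)[OF assms(1)] that by blast
    show "y \<in> {j. (i, j) \<in> M}" if "x \<in> {j. (i, j) \<in> M}" "1 \<le> y" "y \<le> x" for x y
      using youngD(4)[OF assms(1), of i x i y] assms(2) that by simp
  qed
  then show ?thesis unfolding row_len_def by auto
qed

lemma mem_iff_col:
  assumes "young M" "1 \<le> j"
  shows "(i, j) \<in> M \<longleftrightarrow> 1 \<le> i \<and> i \<le> col_len M j"
proof -
  have "{i. (i, j) \<in> M} = {1..card {i. (i, j) \<in> M}}"
  proof (rule initial_segment)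
    show "finite {i. (i, j) \<in> M}" using finite_line[OF assms(1)] by blast
    show "1 \<le> x" if "x \<in> {i. (i, j) \<in> M}" for x using youngD(2)[OF assms(1)] that by blast
    show "y \<in> {i. (i, j) \<in> M}" if "x \<in> {i. (i, j) \<in> M}" "1 \<le> y" "y \<le> x" for x y
      using youngD(4)[OF assms(1), of x j y j] assms(2) that by simp
  qed
  then show ?thesis unfolding col_len_def by auto
qed

lemma row_len_antimono:
  assumes "young M" "1 \<le> i" "i \<le> i'"
  shows "row_len M i' \<le> row_len M i"
proof (rule ccontr)
  assume h: "\<not> row_len M i' \<le> row_len M i"
  then have "(i', row_len M i') \<in> M" using mem_iff_row[of M i'] assms by simp
  then have "(i, row_len M i') \<in> M" using youngD(4)[OF assms(1), of i' "row_len M i'" i "row_len M i'"] assms h by simp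
  then show False using mem_iff_row[of M i] assms h by simp
qed

lemma col_len_antimono:
  assumes "young M" "1 \<le> j" "j \<le> j'"
  shows "col_len M j' \<le> col_len M j"
proof (rule ccontr)
  assume h: "\<not> col_len M j' \<le> col_len M j"
  then have "(col_len M j', j') \<in> M" using mem_iff_col[of M j'] assms by simp
  then have "(col_len M j', j) \<in> M" using youngD(4)[OF assms(1), of "col_len M j'" j' "col_len M j'" j] assms h by simp
  then show False using mem_iff_col[of M j] assms h by simp
qed

lemma row_len_insert:
  assumes "young M" "(i, j) \<notin> M"
  shows "row_len (insert (i, j) M) i' = (if i' = i then Suc (row_len M i) else row_len M i')"
proof (cases "i' = i")
  case True
  have "{j'. (i, j') \<in> insert (i, j) M} = insert j {j'. (i, j') \<in> M}" by auto
  then show ?thesis using True assms finite_line[OF assms(1)] unfolding row_len_def by simp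
qed (simp add: row_len_def)

lemma col_len_insert:
  assumes "young M" "(i, j) \<notin> M"
  shows "col_len (insert (i, j) M) j' = (if j' = j then Suc (col_len M j) else col_len M j')"
proof (cases "j' = j")
  case True
  have "{i'. (i', j) \<in> insert (i, j) M} = insert i {i'. (i', j) \<in> M}" by auto
  then show ?thesis using True assms finite_line[OF assms(1)] unfolding col_len_def by simp
qed (simp add: col_len_def)

lemma addable_len:
  assumes "young M" "(i, j) \<in> addables M"
  shows "Suc (row_len M i) = j" "Suc (col_len M j) = i"
proof -
  have p: "1 \<le> i" "1 \<le> j" using addable_pos assms by auto
  have y: "young (insert (i, j) M)" "(i, j) \<notin> M" using assms(2) unfolding addables_def by auto
  have "j \<le> Suc (row_len M i)"
    using mem_iff_row[OF y(1) p(1), of j] row_len_insert[OF assms(1) y(2), of i] by simp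
  then show "Suc (row_len M i) = j" using mem_iff_row[OF assms(1) p(1), of j] y(2) p by simp
  have "i \<le> Suc (col_len M j)"
    using mem_iff_col[OF y(1) p(2), of i] col_len_insert[OF assms(1) y(2), of j] by simp
  then show "Suc (col_len M j) = i" using mem_iff_col[OF assms(1) p(2), of i] y(2) p by simp
qed

text \<open>With \<open>k = diagonal c\<close>, the row of \<open>c\<close> moves from
  \<open>k - 1\<close> to \<open>k\<close>. Rows above it reach the column of \<open>c\<close> and
  sit beyond \<open>k\<close>; rows below are no longer than it and sit before \<open>k - 1\<close>.
  So the transposition fixes all of these.\<close>

lemma row_pos_insert:
  assumes "young M" "c \<in> addables M" "1 \<le> i"
  shows "row_pos (insert c M) i = swap (diagonal c) (row_pos M i)"
proof -
  obtain a b where ab: "c = (a, b)" by force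
  have c: "(a, b) \<in> addables M" "(a, b) \<notin> M" using assms(2) ab unfolding addables_def by auto
  note len = addable_len[OF assms(1) c(1)]
  note p = addable_pos[OF c(1)]
  consider "i = a" | "i < a" | "a < i" by linarith
  then show ?thesis
  proof cases
    case 1
    then show ?thesis using len row_len_insert[OF assms(1) c(2), of i] ab
      unfolding row_pos_def swap_def diagonal_def by auto
  next
    case 2
    then have "(i, b) \<in> M" using addable_below[OF c(1), of i b] assms(3) p by auto
    then have "b \<le> row_len M i" using mem_iff_row[OF assms(1,3)] by simp
    then show ?thesis using 2 row_len_insert[OF assms(1) c(2), of i] ab
      unfolding row_pos_def swap_def diagonal_def by auto
  next
    case 3
    then have "row_len M i \<le> row_len M a" using row_len_antimono[OF assms(1), of a i] p by auto
    then show ?thesis using 3 len row_len_insert[OF assms(1) c(2), of i] ab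
      unfolding row_pos_def swap_def diagonal_def by auto
  qed
qed

text \<open>Dually, the column of \<open>c\<close> moves from \<open>k\<close> to
  \<open>k - 1\<close>, which the same transposition describes.\<close>

lemma col_pos_insert:
  assumes "young M" "c \<in> addables M" "1 \<le> j"
  shows "col_pos (insert c M) j = swap (diagonal c) (col_pos M j)"
proof -
  obtain a b where ab: "c = (a, b)" by force
  have c: "(a, b) \<in> addables M" "(a, b) \<notin> M" using assms(2) ab unfolding addables_def by auto
  note len = addable_len[OF assms(1) c(1)]
  note p = addable_pos[OF c(1)]
  consider "j = b" | "j < b" | "b < j" by linarith
  then show ?thesis
  proof cases
    case 1
    then show ?thesis using len col_len_insert[OF assms(1) c(2), of j] ab
      unfolding col_pos_def swap_def diagonal_def by auto
  next
    case 2
    then have "(a, j) \<in> M" using addable_below[OF c(1), of a j] assms(3) p by auto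
    then have "a \<le> col_len M j" using mem_iff_col[OF assms(1,3)] by simp
    then show ?thesis using 2 col_len_insert[OF assms(1) c(2), of j] ab
      unfolding col_pos_def swap_def diagonal_def by auto
  next
    case 3
    then have "col_len M j \<le> col_len M b" using col_len_antimono[OF assms(1), of b j] p by auto
    then show ?thesis using 3 len col_len_insert[OF assms(1) c(2), of j] ab
      unfolding col_pos_def swap_def diagonal_def by auto
  qed
qed

text \<open>Rows and columns undergo the same transposition, so enlarging the shape is absorbed into
  the parameters. For this reason the Chevalley formula is proved for all \<open>z\<close> at
  once.\<close>

lemma cell_wt_insert:
  assumes "young L" "c \<in> addables L" "D \<subseteq> L"
  shows "(\<Prod>e\<in>D. cell_wt (insert c L) z e) = (\<Prod>e\<in>D. cell_wt L (z \<circ> swap (diagonal c)) e)"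
proof (rule prod.cong)
  fix e assume "e \<in> D"
  then have "1 \<le> fst e" "1 \<le> snd e" using assms(3) youngD(2,3)[OF assms(1), of "fst e" "snd e"] by auto
  then show "cell_wt (insert c L) z e = cell_wt L (z \<circ> swap (diagonal c)) e"
    unfolding cell_wt_def by (simp add: row_pos_insert[OF assms(1,2)] col_pos_insert[OF assms(1,2)])
qed simp

lemma cell_wt_corner:
  assumes "young L" "c \<in> addables L"
  shows "cell_wt (insert c L) z c = z (diagonal c - 1) / z (diagonal c) - 1"
proof -
  obtain a b where ab: "c = (a, b)" by force
  have c: "(a, b) \<in> addables L" using assms(2) ab by auto
  note len = addable_len[OF assms(1) c(1)]
  note p = addable_pos[OF c(1)]
  have "row_pos L a = diagonal c - 1" "col_pos L b = diagonal c"
    using len ab unfolding row_pos_def col_pos_def diagonal_def by auto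
  then have "row_pos (insert c L) a = diagonal c" "col_pos (insert c L) b = diagonal c - 1"
    using p by (simp_all add: row_pos_insert[OF assms] col_pos_insert[OF assms])
  then show ?thesis unfolding cell_wt_def using ab by simp
qed

section \<open>Recursion of the excited sum under enlarging the outer shape\<close>

lemma exc_sum_cells:
  assumes "young L" "c \<in> addables L"
  shows "(\<Sum>D\<in>exc L M. \<Prod>e\<in>D. cell_wt (insert c L) z e) = exc_sum L (z \<circ> swap (diagonal c)) M"
  unfolding exc_sum_def
proof (rule sum.cong[OF refl])
  fix D assume "D \<in> exc L M"
  then show "(\<Prod>e\<in>D. cell_wt (insert c L) z e) = (\<Prod>e\<in>D. cell_wt L (z \<circ> swap (diagonal c)) e)"
    using exc_subset by (intro cell_wt_insert[OF assms]) blast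
qed

lemma exc_sum_insert_other:
  assumes "young L" "c \<in> addables L" "young M"
    and "\<And>e. e \<in> M \<Longrightarrow> young (M - {e}) \<Longrightarrow> diagonal e \<noteq> diagonal c"
  shows "exc_sum (insert c L) z M = exc_sum L (z \<circ> swap (diagonal c)) M"
proof -
  have "exc (insert c L) M = exc L M"
  proof
    show "exc (insert c L) M \<subseteq> exc L M"
      using exc_insert_dest[OF assms(1-3)] assms(4) by blast
    show "exc L M \<subseteq> exc (insert c L) M" using exc_mono by blast
  qed
  then show ?thesis using exc_sum_cells[OF assms(1,2), of z M] unfolding exc_sum_def by simp
qed

text \<open>Diagrams avoiding \<open>c\<close> are those of \<open>M\<close> in \<open>L\<close>;
  those containing \<open>c\<close> are, apart from \<open>c\<close>, diagrams of \<open>M\<close>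
  or of \<open>M - {e}\<close> in \<open>L\<close>. If \<open>c\<close> has weight \<open>w\<close>,
  the two sums get the coefficients \<open>1 + w\<close> and \<open>w\<close>.\<close>

lemma exc_sum_insert_removable:
  fixes z :: "int \<Rightarrow> 'a::field"
  assumes "young L" "c \<in> addables L" "young M" "e \<in> M" "young (M - {e})" "diagonal e = diagonal c"
  shows "exc_sum (insert c L) z M =
    z (diagonal c - 1) / z (diagonal c) * exc_sum L (z \<circ> swap (diagonal c)) M +
    (z (diagonal c - 1) / z (diagonal c) - 1) * exc_sum L (z \<circ> swap (diagonal c)) (M - {e})"
proof -
  define w where "w = z (diagonal c - 1) / z (diagonal c) - 1"
  define f where "f D = (\<Prod>e\<in>D. cell_wt (insert c L) z e)" for D
  have cL: "c \<notin> L" using assms(2) unfolding addables_def by auto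
  have fin: "finite (exc L N)" "finite L" for N using finite_exc youngD(1) assms(1) by blast+
  have sub: "S \<subseteq> L" if "S \<in> exc L N" for S N using exc_subset that by blast
  let ?I = "insert c ` (exc L M \<union> exc L (M - {e}))"
  have eq: "exc (insert c L) M = exc L M \<union> ?I"
  proof
    show "exc (insert c L) M \<subseteq> exc L M \<union> ?I"
    proof
      fix D assume D: "D \<in> exc (insert c L) M"
      note dest = exc_insert_dest[OF assms(1-3) D]
      show "D \<in> exc L M \<union> ?I"
      proof (cases "c \<in> D")
        case True
        then have "D - {c} \<in> exc L M \<union> exc L (M - {e})"
          using dest removable_unique[of _ M e] assms(3-6) by (metis UnI1 UnI2)
        then show ?thesis using True by (metis UnI2 image_eqI insert_Diff)
      qed (use dest in blast)
    qed
    show "exc L M \<union> ?I \<subseteq> exc (insert c L) M"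
      using exc_insert_intro[OF assms] exc_mono[of _ L M "insert c L"] by blast
  qed
  have "exc L M \<inter> ?I = {}" using sub cL by blast
  then have "exc_sum (insert c L) z M = sum f (exc L M) + sum f ?I"
    unfolding exc_sum_def eq f_def[symmetric] using fin by (simp add: sum.union_disjoint)
  also have "sum f ?I = (\<Sum>D\<in>exc L M \<union> exc L (M - {e}). f (insert c D))"
  proof (rule sum.reindex_cong[OF _ refl refl])
    show "inj_on (insert c) (exc L M \<union> exc L (M - {e}))"
      using sub cL unfolding inj_on_def by (metis Un_iff insert_ident subsetD)
  qed
  also have "\<dots> = (\<Sum>D\<in>exc L M \<union> exc L (M - {e}). w * f D)"
  proof (rule sum.cong[OF refl])
    fix D assume "D \<in> exc L M \<union> exc L (M - {e})"
    then have "D \<subseteq> L" using sub by blast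
    then have "finite D" "c \<notin> D" using fin(2) cL finite_subset by auto
    then show "f (insert c D) = w * f D"
      unfolding f_def w_def using cell_wt_corner[OF assms(1,2), of z] by simp
  qed
  also have "\<dots> = (\<Sum>D\<in>exc L M. w * f D) + (\<Sum>D\<in>exc L (M - {e}). w * f D)"
    using exc_disjoint[OF assms(1,3,5)] assms(4) fin by (intro sum.union_disjoint) blast+
  finally have "exc_sum (insert c L) z M = (1 + w) * sum f (exc L M) + w * sum f (exc L (M - {e}))"
    by (simp add: sum_distrib_left[symmetric] algebra_simps)
  moreover have "sum f (exc L N) = exc_sum L (z \<circ> swap (diagonal c)) N" for N
    unfolding f_def by (rule exc_sum_cells[OF assms(1,2)])
  ultimately show ?thesis unfolding w_def by simp
qed

section \<open>Row weights and corners\<close>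

lemma row_wt_insert:
  assumes "young M" "c \<in> addables M"
  shows "row_wt d z (insert c M) = row_wt d (z \<circ> swap (diagonal c)) M"
  unfolding row_wt_def by (intro prod.cong) (auto simp: row_pos_insert[OF assms])

lemma row_pos_inj:
  assumes "young M"
  shows "inj_on (row_pos M) {1..d}"
proof -
  have "row_pos M i' < row_pos M i" if "1 \<le> i" "i < i'" for i i'
    using row_len_antimono[OF assms that(1), of i'] that unfolding row_pos_def by linarith
  then show ?thesis unfolding inj_on_def by (metis atLeastAtMost_iff less_irrefl linorder_neqE_nat)
qed

lemma row_wt_image:
  assumes "young M"
  shows "row_wt d z M = (\<Prod>p\<in>row_pos M ` {1..d}. z p)"
  unfolding row_wt_def by (simp only: prod.reindex[OF row_pos_inj[OF assms]] comp_def)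

lemma row_wt_addable:
  fixes z :: "int \<Rightarrow> 'a::field"
  assumes "young M" "c \<in> addables M" "fst c \<le> d"
  shows "row_wt d z (insert c M) * z (diagonal c - 1) = row_wt d z M * z (diagonal c)"
proof -
  obtain a b where ab: "c = (a, b)" by force
  have c: "(a, b) \<in> addables M" "(a, b) \<notin> M" using assms(2) ab unfolding addables_def by auto
  note len = addable_len[OF assms(1) c(1)]
  note p = addable_pos[OF c(1)]
  have a: "a \<in> {1..d}" using p assms(3) ab by auto
  have eq: "row_pos (insert c M) i = (if i = a then diagonal c else row_pos M i)" for i
    using row_len_insert[OF assms(1) c(2), of i] len ab unfolding row_pos_def diagonal_def by auto
  have "(\<Prod>i\<in>{1..d} - {a}. z (row_pos (insert c M) i)) = (\<Prod>i\<in>{1..d} - {a}. z (row_pos M i))"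
    by (intro prod.cong) (auto simp: eq)
  moreover have "row_pos M a = diagonal c - 1" using len ab unfolding row_pos_def diagonal_def by auto
  ultimately show ?thesis
    unfolding row_wt_def using prod.remove[OF _ a, of "\<lambda>i. z (row_pos (insert c M) i)"]
      prod.remove[OF _ a, of "\<lambda>i. z (row_pos M i)"] by (simp add: eq)
qed

text \<open>With no corner of content \<open>k\<close>, the positions \<open>k - 1\<close> and
  \<open>k\<close> are both occupied or both free among the first \<open>d\<close> rows, so the
  transposition permutes the occupied positions. The lower bound on \<open>k\<close> keeps the
  cutoff at row \<open>d\<close> from separating the two.\<close>

lemma row_wt_swap_other:
  assumes "young M" "1 - int d \<le> k"
    and rows: "\<And>i j. (i, j) \<in> M \<Longrightarrow> i \<le> d"
    and add: "\<And>c. c \<in> addables M \<Longrightarrow> diagonal c \<noteq> k"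
    and rem: "\<And>e. e \<in> M \<Longrightarrow> young (M - {e}) \<Longrightarrow> diagonal e \<noteq> k"
  shows "row_wt d (z \<circ> swap k) M = row_wt d z M"
proof -
  let ?A = "row_pos M ` {1..d}"
  have 1: "k \<in> ?A" if h: "k - 1 \<in> ?A"
  proof -
    obtain i where i: "1 \<le> i" "i \<le> d" "row_pos M i = k - 1" using h by auto
    let ?j = "Suc (row_len M i)"
    have "diagonal (i, ?j) = k" using i(3) unfolding row_pos_def diagonal_def by simp
    then have na: "(i, ?j) \<notin> addables M" using add by blast
    have "\<not> row_len M i < row_len M (i - 1) \<and> i \<noteq> 1"
    proof (rule ccontr)
      assume h: "\<not> (\<not> row_len M i < row_len M (i - 1) \<and> i \<noteq> 1)"
      have "(i, ?j) \<in> addables M"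
      proof (rule addableI[OF assms(1)])
        show "(i, ?j) \<notin> M" using mem_iff_row[OF assms(1) i(1), of ?j] by simp
        show "(a, b) \<in> M" if ab: "(a, b) \<noteq> (i, ?j)" "1 \<le> a" "a \<le> i" "1 \<le> b" "b \<le> ?j" for a b
        proof (cases "a = i")
          case True
          then show ?thesis using mem_iff_row[OF assms(1) i(1), of b] ab by auto
        next
          case False
          then have "row_len M (i - 1) \<le> row_len M a" "i \<noteq> 1"
            using row_len_antimono[OF assms(1) ab(2), of "i - 1"] ab by auto
          then show ?thesis using mem_iff_row[OF assms(1) ab(2), of b] ab h by auto
        qed
      qed (use i in auto)
      then show False using na by blast
    qed
    \<comment> \<open>The row above must have the same length, hence sits exactly one position
      higher.\<close>
    then have "row_len M (i - 1) = row_len M i" "1 \<le> i - 1"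
      using row_len_antimono[OF assms(1), of "i - 1" i] i by auto
    then have "row_pos M (i - 1) = k" using i unfolding row_pos_def by auto
    then show ?thesis using \<open>1 \<le> i - 1\<close> i by force
  qed
  have 2: "k - 1 \<in> ?A" if h: "k \<in> ?A"
  proof -
    obtain i where i: "1 \<le> i" "i \<le> d" "row_pos M i = k" using h by auto
    let ?j = "row_len M i"
    have "row_len M (Suc i) = row_len M i \<and> Suc i \<le> d"
    proof (cases "?j = 0")
      case True
      \<comment> \<open>An empty row \<open>i\<close> has position \<open>- i\<close>, so the bound
        on \<open>k\<close> yields \<open>Suc i \<le> d\<close>.\<close>
      then show ?thesis using i assms(2) row_len_antimono[OF assms(1) i(1), of "Suc i"]
        unfolding row_pos_def by auto
    next
      case False
      then have m: "(i, ?j) \<in> M" using mem_iff_row[OF assms(1) i(1)] by auto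
      have "diagonal (i, ?j) = k" using i unfolding row_pos_def diagonal_def by auto
      then have "\<not> young (M - {(i, ?j)})" using rem m by blast
      then have "(Suc i, ?j) \<in> M" using young_remove[OF assms(1), of i ?j] mem_iff_row[OF assms(1) i(1), of "Suc ?j"] by auto
      then show ?thesis using rows mem_iff_row[OF assms(1), of "Suc i" ?j]
          row_len_antimono[OF assms(1) i(1), of "Suc i"] by auto
    qed
    then have "row_pos M (Suc i) = k - 1" "Suc i \<in> {1..d}" using i unfolding row_pos_def by auto
    then show ?thesis by (metis imageI)
  qed
  have "swap k p \<in> ?A" if "p \<in> ?A" for p using that 1 2 unfolding swap_def by metis
  then have "swap k ` ?A \<subseteq> ?A" by blast
  moreover have "?A \<subseteq> swap k ` ?A"
    using \<open>\<And>p. p \<in> ?A \<Longrightarrow> swap k p \<in> ?A\<close> by (metis imageI subsetI swap_simps(3))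
  ultimately have img: "swap k ` ?A = ?A" by blast
  have inj: "inj_on (swap k) ?A" by (metis inj_onI swap_simps(3))
  have "row_wt d (z \<circ> swap k) M = (\<Prod>p\<in>?A. z (swap k p))" by (simp only: row_wt_image[OF assms(1)] comp_def)
  also have "\<dots> = (\<Prod>p\<in>swap k ` ?A. z p)" by (simp only: prod.reindex[OF inj] comp_def)
  finally show ?thesis unfolding img row_wt_image[OF assms(1)] .
qed

text \<open>Adding \<open>A\<close> keeps \<open>e\<close> removable exactly when all corners in
  \<open>A\<close> were addable before \<open>e\<close> was present. This makes the correction terms
  for \<open>M\<close> assemble into the Chevalley sum for \<open>M - {e}\<close>.\<close>

lemma addables_add_removable:
  assumes "young M" "e \<in> M" "young (M - {e})"
  defines "B \<equiv> addables (M - {e}) - {e}"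
  shows "addables (M - {e}) = insert e B" "B \<subseteq> addables M"
    "A \<subseteq> addables M \<Longrightarrow> young (M \<union> A - {e}) \<longleftrightarrow> A \<subseteq> B"
proof -
  have e: "e \<in> addables (M - {e})"
    using assms(1,2) unfolding addables_def by (simp add: insert_absorb)
  then show "addables (M - {e}) = insert e B" unfolding B_def by blast
  show B: "B \<subseteq> addables M"
  proof
    fix f assume "f \<in> B"
    then have f: "f \<in> addables (M - {e})" "f \<noteq> e" unfolding B_def by auto
    then have "f \<in> addables (M - {e} \<union> {e})"
      using addables_mono[OF assms(3), of "{e}" f] e by blast
    then show "f \<in> addables M" using assms(2) by (simp add: insert_absorb)
  qed
  assume A: "A \<subseteq> addables M"
  then have eA: "e \<notin> A" using assms(2) unfolding addables_def by auto
  show "young (M \<union> A - {e}) \<longleftrightarrow> A \<subseteq> B"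
  proof
    assume y: "young (M \<union> A - {e})"
    show "A \<subseteq> B"
    proof
      fix f assume f: "f \<in> A"
      have "f \<notin> M" "f \<noteq> e" using f A eA unfolding addables_def by auto
      have "young (insert f M)" using f A unfolding addables_def by auto
      then have "young (insert f M \<inter> (M \<union> A - {e}))" using y by (rule young_Int)
      moreover have "insert f M \<inter> (M \<union> A - {e}) = insert f (M - {e})" using f \<open>f \<noteq> e\<close> by blast
      ultimately show "f \<in> B" using \<open>f \<notin> M\<close> \<open>f \<noteq> e\<close> unfolding B_def addables_def by simp
    qed
  next
    assume "A \<subseteq> B"
    then have "young (M - {e} \<union> A)" using young_Un_addables[OF assms(3)] unfolding B_def by blast
    moreover have "M - {e} \<union> A = M \<union> A - {e}" using eA by blast
    ultimately show "young (M \<union> A - {e})" by simp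
  qed
qed

lemma removable_Un_addables:
  assumes "young M" "A \<subseteq> addables M" "e \<in> M \<union> A" "young (M \<union> A - {e})"
  shows "e \<in> A \<or> young (M - {e})"
proof (cases "e \<in> A")
  case False
  have "young (M \<inter> (M \<union> A - {e}))" using assms(1,4) by (rule young_Int)
  moreover have "M \<inter> (M \<union> A - {e}) = M - {e}" by blast
  ultimately show ?thesis by simp
qed blast

lemma sum_Pow_insert:
  assumes "finite B" "e \<notin> B"
  shows "(\<Sum>A\<in>Pow (insert e B). f A) = (\<Sum>A\<in>Pow B. f A + f (insert e A))"
proof -
  have "(\<Sum>A\<in>Pow (insert e B). f A) = (\<Sum>A\<in>Pow B. f A) + (\<Sum>A\<in>insert e ` Pow B. f A)"
    unfolding Pow_insert using assms by (intro sum.union_disjoint) auto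
  also have "(\<Sum>A\<in>insert e ` Pow B. f A) = (\<Sum>A\<in>Pow B. f (insert e A))"
  proof (rule sum.reindex_cong[OF _ refl refl])
    show "inj_on (insert e) (Pow B)" using assms(2) unfolding inj_on_def by (metis PowD insert_ident subsetD)
  qed
  finally show ?thesis by (simp add: sum.distrib)
qed

lemma exc_sum_eq_0: "\<not> M \<subseteq> L \<Longrightarrow> exc_sum L z M = 0"
  unfolding exc_sum_def using exc_empty by simp

text \<open>Adding a corner \<open>c\<close> of content \<open>k\<close> to \<open>L\<close> exchanges the parameters at \<open>k - 1\<close> and \<open>k\<close>,
  and the same exchange describes adding or removing a cell of content \<open>k\<close> in \<open>M\<close>;
  the induction therefore splits according to what \<open>M\<close> has on the diagonal of \<open>c\<close>.\<close>

theorem chevalley: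
  fixes z :: "int \<Rightarrow> 'a::field"
  assumes "young L" "young M" "\<And>i j. (i, j) \<in> L \<Longrightarrow> i \<le> d" "\<And>p. z p \<noteq> 0"
  shows "row_wt d z L * (\<Sum>A\<in>Pow (addables M). exc_sum L z (M \<union> A)) = row_wt d z M * exc_sum L z M"
  using assms
proof (induction arbitrary: M z rule: young_induct)
  case empty
  show ?case
  proof (cases "M = {}")
    case True
    \<comment> \<open>Over the empty shape a summand survives only if \<open>M \<union> A\<close> is
      empty.\<close>
    have "(\<Sum>A\<in>Pow (addables M). exc_sum {} z (M \<union> A)) = (\<Sum>A\<in>{{}}. exc_sum {} z (M \<union> A))"
      using addables_finite[OF empty(1)] True
      by (intro sum.mono_neutral_right) (auto intro!: exc_sum_eq_0)
    then show ?thesis using True by simp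
  next
    case False
    then have "exc_sum {} z (M \<union> A) = 0" for A by (intro exc_sum_eq_0) auto
    from this[of "{}"] this show ?thesis by simp
  qed
next
  case (insert L c)
  let ?L = "insert c L" and ?k = "diagonal c"
  let ?z = "z \<circ> swap ?k"
  let ?w = "z (?k - 1) / z ?k"
  have cL: "c \<notin> L" using insert(2) unfolding addables_def by auto
  have rows: "i \<le> d" if "(i, j) \<in> L" for i j using insert(5) that by blast
  have nz: "?z p \<noteq> 0" for p using insert(6) by simp
  \<comment> \<open>The hypothesis enters with exchanged parameters, for \<open>M\<close> and, in
    the removable case, also for \<open>M - {e}\<close>.\<close>
  have IH: "row_wt d ?z L * (\<Sum>A\<in>Pow (addables N). exc_sum L ?z (N \<union> A)) = row_wt d ?z N * exc_sum L ?z N"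
    if "young N" for N using insert(3)[OF that] rows nz by blast
  have wt: "row_wt d z ?L = row_wt d ?z L" using row_wt_insert[OF insert(1,2)] .
  have yA: "young (M \<union> A)" if "A \<subseteq> addables M" for A using young_Un_addables insert(4) that .
  have finA: "finite (addables M)" using addables_finite[OF insert(4)] .
  show ?case
  proof (cases "M \<subseteq> ?L")
    case False
    then have "exc_sum ?L z (M \<union> A) = 0" for A by (intro exc_sum_eq_0) auto
    from this[of "{}"] this show ?thesis by simp
  next
    case True
    then have Mrows: "i \<le> d" if "(i, j) \<in> M" for i j using insert(5) that by blast
    have cd: "fst c \<le> d" "1 \<le> snd c"
      using insert(5)[of "fst c" "snd c"] addable_pos[of "fst c" "snd c" L] insert(2) by auto
    then have kd: "1 - int d \<le> ?k" unfolding diagonal_def by linarith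
    have other: "exc_sum ?L z N = exc_sum L ?z N"
      if "young N" "\<And>e. e \<in> N \<Longrightarrow> young (N - {e}) \<Longrightarrow> diagonal e \<noteq> ?k" for N
      using exc_sum_insert_other[OF insert(1,2) that] .
    have remov: "exc_sum ?L z N = ?w * exc_sum L ?z N + (?w - 1) * exc_sum L ?z (N - {e})"
      if "young N" "e \<in> N" "young (N - {e})" "diagonal e = ?k" for N e
      using exc_sum_insert_removable[OF insert(1,2) that] .
    consider (add) e where "e \<in> addables M" "diagonal e = ?k"
      | (rem) e where "e \<in> M" "young (M - {e})" "diagonal e = ?k"
      | (neither) "\<And>e. e \<in> addables M \<Longrightarrow> diagonal e \<noteq> ?k"
          "\<And>e. e \<in> M \<Longrightarrow> young (M - {e}) \<Longrightarrow> diagonal e \<noteq> ?k"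
      by metis
    then show ?thesis
    proof cases
      case add
      define B where "B = addables M - {e}"
      have B: "addables M = insert e B" "e \<notin> B" "finite B" using add(1) finA unfolding B_def by auto
      \<comment> \<open>In a row below \<open>d\<close>, hence below \<open>c\<close>, equal content
        would force \<open>e\<close> into a column after the first, and the first cell of that row
        would be a cell of \<open>M\<close> outside the first \<open>d\<close> rows.\<close>
      have ed: "fst e \<le> d"
      proof (rule ccontr)
        assume h: "\<not> fst e \<le> d"
        then have "fst c < fst e" using cd by simp
        obtain a b i j where ij: "c = (a, b)" "e = (i, j)" by force
        have p: "1 \<le> i" "1 \<le> j" using addable_pos add(1) ij by auto
        have "Suc d \<le> i" using h ij by simp
        moreover have "2 \<le> j" using kd add(2) cd ij \<open>fst c < fst e\<close> unfolding diagonal_def by auto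
        ultimately have "(i, 1) \<in> M" using addable_below[of i j M i 1] add(1) p ij by auto
        then show False using Mrows h ij by auto
      qed
      \<comment> \<open>Only the second member of the pair has a removable corner of content
        \<open>?k\<close>. Its correction term, \<open>?w - 1\<close> times the sum at
        \<open>M \<union> A\<close>, raises the coefficient of the first member from 1 to
        \<open>?w\<close>.\<close>
      have pair: "exc_sum ?L z (M \<union> A) + exc_sum ?L z (M \<union> insert e A) =
          ?w * (exc_sum L ?z (M \<union> A) + exc_sum L ?z (M \<union> insert e A))" if A: "A \<in> Pow B" for A
      proof -
        have AM: "A \<subseteq> addables M" "insert e A \<subseteq> addables M" "e \<notin> A" using A B by auto
        have e: "e \<in> addables (M \<union> A)" using addables_mono[OF insert(4) AM(1,3) add(1)] .
        have eN: "e \<notin> M \<union> A" using e unfolding addables_def by auto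
        have "exc_sum ?L z (M \<union> A) = exc_sum L ?z (M \<union> A)"
          using other[OF yA[OF AM(1)]] addable_not_removable[OF yA[OF AM(1)] e] add(2) by metis
        moreover have "M \<union> insert e A - {e} = M \<union> A" using eN by blast
        then have "exc_sum ?L z (M \<union> insert e A) =
            ?w * exc_sum L ?z (M \<union> insert e A) + (?w - 1) * exc_sum L ?z (M \<union> A)"
          using remov[OF yA[OF AM(2)], of e] yA[OF AM(1)] add(2) by simp
        ultimately show ?thesis by (simp add: algebra_simps)
      qed
      have "(\<Sum>A\<in>Pow (addables M). exc_sum ?L z (M \<union> A)) =
          ?w * (\<Sum>A\<in>Pow (addables M). exc_sum L ?z (M \<union> A))"
        unfolding B(1) sum_Pow_insert[OF B(3,2)] sum_distrib_left by (rule sum.cong[OF refl pair])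
      then have "row_wt d z ?L * (\<Sum>A\<in>Pow (addables M). exc_sum ?L z (M \<union> A)) =
          ?w * (row_wt d ?z M * exc_sum L ?z M)"
        using IH[OF insert(4)] wt by (simp add: mult.left_commute)
      \<comment> \<open>On \<open>row_wt\<close> the exchange acts like adding \<open>e\<close>, and
        the factor \<open>?w\<close> undoes precisely this change.\<close>
      also have "row_wt d ?z M = row_wt d z (insert e M)"
        using row_wt_insert[OF insert(4) add(1), of d z] add(2) by simp
      also have "?w * (row_wt d z (insert e M) * exc_sum L ?z M) = row_wt d z M * exc_sum L ?z M"
        using row_wt_addable[OF insert(4) add(1) ed, of z] add(2) insert(6) by (simp add: field_simps)
      also have "exc_sum L ?z M = exc_sum ?L z M"
        using other[OF insert(4)] addable_not_removable[OF insert(4) add(1)] add(2) by metis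
      finally show ?thesis .
    next
      case rem
      let ?N = "M - {e}"
      define B where "B = addables ?N - {e}"
      note B = addables_add_removable[OF insert(4) rem(1,2), folded B_def]
      have eA: "e \<in> addables ?N" using B(1) by blast
      have finB: "finite B" "e \<notin> B" using finite_subset[OF B(2) finA] by (auto simp: B_def)
      \<comment> \<open>The correction from \<open>remov\<close> appears exactly when
        \<open>e\<close> is still removable from \<open>M \<union> A\<close>, that is, for
        \<open>A \<subseteq> B\<close>.\<close>
      have eq: "exc_sum ?L z (M \<union> A) = exc_sum L ?z (M \<union> A) +
          (if A \<in> Pow B then (?w - 1) * (exc_sum L ?z (M \<union> A) + exc_sum L ?z (?N \<union> A)) else 0)"
        if "A \<in> Pow (addables M)" for A
      proof (cases "A \<subseteq> B")
        case True
        have "young (M \<union> A - {e})" using B(3) that True by blast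
        moreover have "M \<union> A - {e} = ?N \<union> A" using True finB by blast
        ultimately show ?thesis using remov[OF yA, of A e] that True rem by (simp add: algebra_simps)
      next
        case False
        have "diagonal f \<noteq> ?k" if f: "f \<in> M \<union> A" "young (M \<union> A - {f})" for f
        proof
          assume d: "diagonal f = ?k"
          have "f \<notin> A" using addable_not_removable[OF insert(4) _ rem(1,2)] d rem(3) \<open>A \<in> Pow (addables M)\<close>
            by (metis PowD subsetD)
          then have "f \<in> M" "young (M - {f})"
            using removable_Un_addables[OF insert(4) _ f] f \<open>A \<in> Pow (addables M)\<close> by auto
          then have "f = e" using removable_unique[of f M e] rem d insert(4) by simp
          then show False using f B(3) \<open>A \<in> Pow (addables M)\<close> False by blast
        qed
        then show ?thesis using other[OF yA, of A] that False by simp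
      qed
      have "(\<Sum>A\<in>Pow (addables M). exc_sum ?L z (M \<union> A)) =
          (\<Sum>A\<in>Pow (addables M). exc_sum L ?z (M \<union> A)) +
          (\<Sum>A\<in>Pow (addables M). if A \<in> Pow B then (?w - 1) * (exc_sum L ?z (M \<union> A) + exc_sum L ?z (?N \<union> A)) else 0)"
        unfolding sum.distrib[symmetric] by (rule sum.cong[OF refl eq])
      also have "(\<Sum>A\<in>Pow (addables M). if A \<in> Pow B then (?w - 1) * (exc_sum L ?z (M \<union> A) + exc_sum L ?z (?N \<union> A)) else 0)
          = (\<Sum>A\<in>Pow B. (?w - 1) * (exc_sum L ?z (?N \<union> A) + exc_sum L ?z (?N \<union> insert e A)))"
      proof -
        have 1: "Pow (addables M) \<inter> Pow B = Pow B" using B(2) by blast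
        \<comment> \<open>Read this way, the corrections run over all sets of addable corners of
          \<open>?N\<close>, those without \<open>e\<close> and those with \<open>e\<close>.\<close>
        have 2: "?N \<union> insert e A = M \<union> A" for A using rem(1) by blast
        have "finite (Pow (addables M))" using finA by simp
        then show ?thesis by (simp only: sum.inter_restrict[symmetric] 1 2 add.commute)
      qed
      also have "\<dots> = (?w - 1) * (\<Sum>A\<in>Pow (addables ?N). exc_sum L ?z (?N \<union> A))"
        unfolding B(1) sum_Pow_insert[OF finB] sum_distrib_left ..
      finally have "row_wt d z ?L * (\<Sum>A\<in>Pow (addables M). exc_sum ?L z (M \<union> A)) =
          row_wt d ?z L * (\<Sum>A\<in>Pow (addables M). exc_sum L ?z (M \<union> A)) +
          (?w - 1) * (row_wt d ?z L * (\<Sum>A\<in>Pow (addables ?N). exc_sum L ?z (?N \<union> A)))"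
        unfolding wt by (simp only: distrib_left mult.left_commute)
      also have "\<dots> = row_wt d ?z M * exc_sum L ?z M + (?w - 1) * (row_wt d ?z ?N * exc_sum L ?z ?N)"
        unfolding IH[OF insert(4)] IH[OF rem(2)] ..
      \<comment> \<open>Removing \<open>e\<close> and exchanging parameters cancel in the second
        weight, while the first becomes \<open>?w\<close> times \<open>row_wt d z M\<close>. With
        this common factor taken out, \<open>remov\<close> for \<open>M\<close> remains.\<close>
      also have "row_wt d ?z ?N = row_wt d z M"
        using row_wt_insert[OF rem(2) eA, of d z] rem(1,3) by (simp add: insert_absorb)
      also have "row_wt d ?z M = row_wt d z ?N"
      proof -
        have "?z \<circ> swap ?k = z" by (auto simp: fun_eq_iff)
        then show ?thesis using row_wt_insert[OF rem(2) eA, of d ?z] rem(1,3) by (simp add: insert_absorb)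
      qed
      also have "row_wt d z ?N = ?w * row_wt d z M"
      proof -
        have "fst e \<le> d" using Mrows[of "fst e" "snd e"] rem(1) by simp
        from row_wt_addable[OF rem(2) eA this, of z] show ?thesis
          using rem(1,3) insert(6) by (simp add: insert_absorb field_simps)
      qed
      finally show ?thesis unfolding remov[OF insert(4) rem] by (simp add: algebra_simps comp_def)
    next
      case neither
      have eq: "exc_sum ?L z (M \<union> A) = exc_sum L ?z (M \<union> A)" if "A \<in> Pow (addables M)" for A
      proof (rule other)
        show "young (M \<union> A)" using yA that by blast
        show "diagonal f \<noteq> ?k" if f: "f \<in> M \<union> A" "young (M \<union> A - {f})" for f
          using removable_Un_addables[OF insert(4) _ f] neither f \<open>A \<in> Pow (addables M)\<close> by blast
      qed
      have "row_wt d z ?L * (\<Sum>A\<in>Pow (addables M). exc_sum ?L z (M \<union> A)) = row_wt d ?z M * exc_sum L ?z M"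
        unfolding wt using IH[OF insert(4)] by (simp only: sum.cong[OF refl eq])
      also have "row_wt d ?z M = row_wt d z M"
        by (rule row_wt_swap_other[OF insert(4) kd Mrows neither])
      also have "exc_sum L ?z M = exc_sum ?L z M" by (rule other[OF insert(4) neither(2), symmetric])
      finally show ?thesis .
    qed
  qed
qed

section \<open>Increasing tableaux\<close>

definition inc_tabs :: "(nat \<times> nat) set \<Rightarrow> (nat \<times> nat) set \<Rightarrow> (nat \<times> nat \<Rightarrow> nat) set" where
  "inc_tabs L M = {T. (\<forall>c. c \<notin> L - M \<longrightarrow> T c = 0)
      \<and> (\<forall>c\<in>L - M. T c \<ge> 1)
      \<and> (\<forall>i j j'. (i, j) \<in> L - M \<longrightarrow> (i, j') \<in> L - M \<longrightarrow> j < j' \<longrightarrow> T (i, j) < T (i, j'))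
      \<and> (\<forall>i i' j. (i, j) \<in> L - M \<longrightarrow> (i', j) \<in> L - M \<longrightarrow> i < i' \<longrightarrow> T (i, j) < T (i', j))
      \<and> (\<exists>m. T ` (L - M) = {1..m})}"

definition tab_sum :: "((nat \<times> nat) set \<Rightarrow> 'a::comm_ring_1) \<Rightarrow> (nat \<times> nat) set \<Rightarrow> (nat \<times> nat) set \<Rightarrow> 'a" where
  "tab_sum g L M = (\<Sum>T\<in>inc_tabs L M. \<Prod>k\<in>{1..card (T ` (L - M))}. g (M \<union> {c \<in> L - M. T c < k}))"

text \<open>The inverse of stripping the entries 1: \<open>A\<close> is the restored first layer and
  \<open>R\<close> the rest of the skew shape.\<close>

definition raise :: "(nat \<times> nat) set \<Rightarrow> (nat \<times> nat) set \<Rightarrow> (nat \<times> nat \<Rightarrow> nat) \<Rightarrow> nat \<times> nat \<Rightarrow> nat" where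
  "raise R A T c = (if c \<in> A then 1 else if c \<in> R then Suc (T c) else 0)"

lemma inc_tabsI:
  assumes "\<And>c. c \<notin> L - M \<Longrightarrow> T c = 0" "\<And>c. c \<in> L - M \<Longrightarrow> T c \<ge> 1"
    "\<And>i j j'. (i, j) \<in> L - M \<Longrightarrow> (i, j') \<in> L - M \<Longrightarrow> j < j' \<Longrightarrow> T (i, j) < T (i, j')"
    "\<And>i i' j. (i, j) \<in> L - M \<Longrightarrow> (i', j) \<in> L - M \<Longrightarrow> i < i' \<Longrightarrow> T (i, j) < T (i', j)"
    "T ` (L - M) = {1..m}"
  shows "T \<in> inc_tabs L M"
  unfolding inc_tabs_def mem_Collect_eq
  by (intro conjI allI impI ballI exI[of _ m]) (rule assms; assumption)+

lemma inc_tabsD: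
  assumes "T \<in> inc_tabs L M"
  shows "c \<notin> L - M \<Longrightarrow> T c = 0" "c \<in> L - M \<Longrightarrow> T c \<ge> 1"
    "(i, j) \<in> L - M \<Longrightarrow> (i, j') \<in> L - M \<Longrightarrow> j < j' \<Longrightarrow> T (i, j) < T (i, j')"
    "(i, j) \<in> L - M \<Longrightarrow> (i', j) \<in> L - M \<Longrightarrow> i < i' \<Longrightarrow> T (i, j) < T (i', j)"
    "T ` (L - M) = {1..card (T ` (L - M))}"
proof -
  note T = assms[unfolded inc_tabs_def mem_Collect_eq]
  note T1 = T[THEN conjunct1, rule_format]
    and T2 = T[THEN conjunct2, THEN conjunct1, rule_format]
    and T3 = T[THEN conjunct2, THEN conjunct2, THEN conjunct1, rule_format]
    and T4 = T[THEN conjunct2, THEN conjunct2, THEN conjunct2, THEN conjunct1, rule_format]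
    and T5 = T[THEN conjunct2, THEN conjunct2, THEN conjunct2, THEN conjunct2]
  show "c \<notin> L - M \<Longrightarrow> T c = 0" by (rule T1)
  show "c \<in> L - M \<Longrightarrow> T c \<ge> 1" by (rule T2)
  show "(i, j) \<in> L - M \<Longrightarrow> (i, j') \<in> L - M \<Longrightarrow> j < j' \<Longrightarrow> T (i, j) < T (i, j')" by (rule T3)
  show "(i, j) \<in> L - M \<Longrightarrow> (i', j) \<in> L - M \<Longrightarrow> i < i' \<Longrightarrow> T (i, j) < T (i', j)" by (rule T4)
  obtain m where m: "T ` (L - M) = {1..m}" using T5 by (rule exE)
  show "T ` (L - M) = {1..card (T ` (L - M))}" unfolding m by simp
qed

lemma finite_inc_tabs:
  assumes "finite L" shows "finite (inc_tabs L M)"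
proof (rule finite_subset)
  have fin: "finite (L - M)" using assms by simp
  show "inc_tabs L M \<subseteq> {T. \<forall>c. (c \<in> L - M \<longrightarrow> T c \<in> {0..card (L - M)}) \<and> (c \<notin> L - M \<longrightarrow> T c = 0)}"
  proof (intro subsetI CollectI allI conjI impI)
    fix T c assume T: "T \<in> inc_tabs L M"
    show "T c = 0" if "c \<notin> L - M" using inc_tabsD(1)[OF T that] .
    show "T c \<in> {0..card (L - M)}" if "c \<in> L - M"
    proof -
      have "T c \<in> {1..card (T ` (L - M))}" using inc_tabsD(5)[OF T] that by blast
      then show ?thesis using card_image_le[OF fin, of T] by simp
    qed
  qed
  show "finite {T. \<forall>c. (c \<in> L - M \<longrightarrow> T c \<in> {0..card (L - M)}) \<and> (c \<notin> L - M \<longrightarrow> T c = (0::nat))}"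
    using fin by (intro finite_set_of_finite_funs) auto
qed

lemma inc_tabs_self: "inc_tabs L L = {\<lambda>_. 0}"
  unfolding inc_tabs_def by (auto intro!: exI[of _ 0])

lemma tab_sum_self: "tab_sum g L L = 1"
  unfolding tab_sum_def inc_tabs_self by simp

text \<open>Entries decrease towards the upper left, so every other cell weakly above and left of an
  entry 1 lies in \<open>M\<close>. Since the entries fill an interval from 1, the layer is nonempty
  and the lowered filling is again standard.\<close>

lemma first_entries:
  assumes "young L" "young M" "M \<subseteq> L" "M \<noteq> L" "T \<in> inc_tabs L M"
  defines "A \<equiv> {c \<in> L - M. T c = 1}"
  shows "A \<noteq> {}" "A \<subseteq> addables M" "A \<subseteq> L" "(\<lambda>c. T c - 1) \<in> inc_tabs L (M \<union> A)"
    "card (T ` (L - M)) = Suc (card ((\<lambda>c. T c - 1) ` (L - (M \<union> A))))"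
    "raise (L - (M \<union> A)) A (\<lambda>c. T c - 1) = T"
proof -
  note T = inc_tabsD[OF assms(5)]
  let ?n = "card (T ` (L - M))"
  have fin: "finite (L - M)" using youngD(1)[OF assms(1)] by simp
  have ne: "L - M \<noteq> {}" using assms(3,4) by blast
  then have n: "1 \<le> ?n" using fin by (simp add: Suc_le_eq card_gt_0_iff)
  then have "1 \<in> T ` (L - M)" using T(5) by auto
  then show "A \<noteq> {}" unfolding A_def by force
  show "A \<subseteq> L" unfolding A_def by blast
  show "A \<subseteq> addables M"
  proof
    fix c assume c: "c \<in> A"
    obtain i j where ij: "c = (i, j)" by force
    have cL: "(i, j) \<in> L" "(i, j) \<notin> M" "T (i, j) = 1" using c ij unfolding A_def by auto
    have "(i, j) \<in> addables M"
    proof (rule addableI[OF assms(2) cL(2)])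
      show p: "1 \<le> i" "1 \<le> j" using youngD(2,3)[OF assms(1) cL(1)] by auto
      fix a b assume ab: "(a, b) \<noteq> (i, j)" "1 \<le> a" "a \<le> i" "1 \<le> b" "b \<le> j"
      show "(a, b) \<in> M"
      proof (rule ccontr)
        assume nM: "(a, b) \<notin> M"
        have 1: "(a, b) \<in> L - M" using nM youngD(4)[OF assms(1) cL(1), of a b] ab by simp
        have 2: "(a, j) \<in> L - M" using nM youngD(4)[OF assms(1) cL(1), of a j]
            youngD(4)[OF assms(2), of a j a b] ab p by auto
        have 3: "(i, j) \<in> L - M" using cL by simp
        \<comment> \<open>The path from \<open>(a, b)\<close> along its row to \<open>(a, j)\<close>
          and down to \<open>(i, j)\<close> has at least one nontrivial leg, so
          \<open>T (a, b)\<close> would be below 1.\<close>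
        have "T (a, b) \<le> T (a, j)" using T(3)[OF 1 2] ab by (cases "b = j") auto
        moreover have "T (a, j) \<le> T (i, j)" using T(4)[OF 2 3] ab by (cases "a = i") auto
        moreover have "T (a, b) < T (a, j) \<or> T (a, j) < T (i, j)"
          using T(3)[OF 1 2] T(4)[OF 2 3] ab by (metis le_neq_implies_less)
        ultimately show False using T(2)[OF 1] cL(3) by linarith
      qed
    qed
    then show "c \<in> addables M" using ij by simp
  qed
  have big: "2 \<le> T c" if "c \<in> L - (M \<union> A)" for c
    using T(2)[of c] that unfolding A_def by force
  have "T ` (L - (M \<union> A)) = {2..?n}"
  proof
    show "T ` (L - (M \<union> A)) \<subseteq> {2..?n}"
    proof
      fix x assume "x \<in> T ` (L - (M \<union> A))"
      then obtain c where c: "c \<in> L - (M \<union> A)" "x = T c" by blast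
      then have "x \<in> T ` (L - M)" by blast
      then have "x \<le> ?n" using T(5) by (metis atLeastAtMost_iff)
      then show "x \<in> {2..?n}" using big[OF c(1)] c(2) by simp
    qed
    show "{2..?n} \<subseteq> T ` (L - (M \<union> A))"
    proof
      fix x assume x: "x \<in> {2..?n}"
      then have "x \<in> T ` (L - M)" using T(5) by (metis atLeastAtMost_iff le_trans one_le_numeral)
      then obtain c where "c \<in> L - M" "T c = x" by blast
      then show "x \<in> T ` (L - (M \<union> A))" using x unfolding A_def by force
    qed
  qed
  moreover have "(\<lambda>c. T c - 1) ` (L - (M \<union> A)) = (\<lambda>x. x - 1) ` T ` (L - (M \<union> A))"
    by (simp only: image_image)
  ultimately have "(\<lambda>c. T c - 1) ` (L - (M \<union> A)) = (\<lambda>x. x - 1) ` {2..?n}" by simp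
  also have "\<dots> = {1..?n - 1}"
  proof
    show "{1..?n - 1} \<subseteq> (\<lambda>x. x - 1) ` {2..?n}"
    proof
      fix x assume "x \<in> {1..?n - 1}"
      then have "Suc x \<in> {2..?n}" "x = Suc x - 1" by auto
      then show "x \<in> (\<lambda>x. x - 1) ` {2..?n}" by blast
    qed
  qed auto
  finally have img: "(\<lambda>c. T c - 1) ` (L - (M \<union> A)) = {1..?n - 1}" .
  then show "?n = Suc (card ((\<lambda>c. T c - 1) ` (L - (M \<union> A))))" using n by simp
  show "(\<lambda>c. T c - 1) \<in> inc_tabs L (M \<union> A)"
  proof (rule inc_tabsI)
    show "T c - 1 = 0" if "c \<notin> L - (M \<union> A)" for c
      using T(1)[of c] that unfolding A_def by force
    show "1 \<le> T c - 1" if "c \<in> L - (M \<union> A)" for c using big[OF that] by simp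
    show "T (i, j) - 1 < T (i, j') - 1" if "(i, j) \<in> L - (M \<union> A)" "(i, j') \<in> L - (M \<union> A)" "j < j'" for i j j'
      using T(3)[of i j j'] big[OF that(1)] that by auto
    show "T (i, j) - 1 < T (i', j) - 1" if "(i, j) \<in> L - (M \<union> A)" "(i', j) \<in> L - (M \<union> A)" "i < i'" for i i' j
      using T(4)[of i j i'] big[OF that(1)] that by auto
    show "(\<lambda>c. T c - 1) ` (L - (M \<union> A)) = {1..?n - 1}" by (rule img)
  qed
  show "raise (L - (M \<union> A)) A (\<lambda>c. T c - 1) = T"
  proof
    fix c
    show "raise (L - (M \<union> A)) A (\<lambda>c. T c - 1) c = T c"
      using T(1,2)[of c] unfolding raise_def A_def by auto
  qed
qed

text \<open>No cell of \<open>A\<close> lies weakly below and right of another cell of the skew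
  shape, so placing ones on \<open>A\<close> and raising the rest keeps rows and columns
  strict.\<close>

lemma raise_inc_tabs:
  assumes "young M" "A \<subseteq> addables M" "A \<subseteq> L" "A \<noteq> {}" "young L" "T \<in> inc_tabs L (M \<union> A)"
  defines "R \<equiv> raise (L - (M \<union> A)) A T"
  shows "R \<in> inc_tabs L M" "{c \<in> L - M. R c = 1} = A" "(\<lambda>c. R c - 1) = T"
proof -
  note T = inc_tabsD[OF assms(6)]
  let ?n = "card (T ` (L - (M \<union> A)))"
  have AM: "A \<inter> M = {}" using assms(2) unfolding addables_def by auto
  have pos: "1 \<le> i" "1 \<le> j" if "(i, j) \<in> L" for i j using youngD(2,3)[OF assms(5) that] by auto
  have inA: "R c = 1" if "c \<in> A" for c using that unfolding R_def raise_def by simp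
  have notA: "R c = Suc (T c)" "1 \<le> T c" if "c \<in> L - M" "c \<notin> A" for c
    using that T(2)[of c] unfolding R_def raise_def by auto
  have out: "R c = 0" if "c \<notin> L - M" for c
    using that assms(3) AM unfolding R_def raise_def by auto
  have corner: "(i', j') \<notin> A" if "(i, j) \<in> L - M" "(i', j') \<noteq> (i, j)" "i \<le> i'" "j \<le> j'" for i j i' j'
    using addable_below[of i' j' M i j] assms(2) that pos[of i j] by auto
  have step: "R (i, j) < R (i', j')"
    if h: "(i, j) \<in> L - M" "(i', j') \<in> L - M" "(i', j') \<noteq> (i, j)" "i \<le> i'" "j \<le> j'"
      and lt: "(i, j) \<notin> A \<Longrightarrow> T (i, j) < T (i', j')" for i j i' j'
    using corner[OF h(1,3-5)] notA[OF h(2)] notA[OF h(1)] inA[of "(i, j)"] lt by (cases "(i, j) \<in> A") auto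
  have "L - M = A \<union> (L - (M \<union> A))" using assms(3) AM by blast
  then have "R ` (L - M) = R ` A \<union> R ` (L - (M \<union> A))" by (metis image_Un)
  also have "R ` A = {1}" using inA assms(4) by force
  also have "R ` (L - (M \<union> A)) = Suc ` T ` (L - (M \<union> A))"
    unfolding image_image using notA(1) by (intro image_cong) auto
  also have "\<dots> = {2..Suc ?n}" by (subst T(5)) (simp add: image_Suc_atLeastAtMost numeral_2_eq_2)
  also have "{1} \<union> {2..Suc ?n} = {1..Suc ?n}" by auto
  finally have img: "R ` (L - M) = {1..Suc ?n}" .
  show "R \<in> inc_tabs L M"
  proof (rule inc_tabsI[OF _ _ _ _ img])
    show "R c = 0" if "c \<notin> L - M" for c using out[OF that] .
    show "1 \<le> R c" if "c \<in> L - M" for c using notA(1)[OF that] inA[of c] by (cases "c \<in> A") auto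
    show "R (i, j) < R (i, j')" if "(i, j) \<in> L - M" "(i, j') \<in> L - M" "j < j'" for i j j'
      using corner[OF that(1), of i j'] that by (intro step T(3)) auto
    show "R (i, j) < R (i', j)" if "(i, j) \<in> L - M" "(i', j) \<in> L - M" "i < i'" for i i' j
      using corner[OF that(1), of i' j] that by (intro step T(4)) auto
  qed
  show "{c \<in> L - M. R c = 1} = A"
    using inA notA AM assms(3) by (auto, force)
  show "(\<lambda>c. R c - 1) = T"
  proof
    fix c show "R c - 1 = T c" using T(1)[of c] unfolding R_def raise_def by auto
  qed
qed

text \<open>The cells with entry 1 form a nonempty set \<open>A\<close> of addable corners of \<open>M\<close>;
  removing them and lowering all other entries gives a tableau of shape \<open>L/(M \<union> A)\<close>.\<close>

lemma tab_sum_rec: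
  fixes g :: "(nat \<times> nat) set \<Rightarrow> 'a::comm_ring_1"
  assumes "young L" "young M" "M \<subseteq> L" "M \<noteq> L"
  shows "tab_sum g L M = g M * (\<Sum>A\<in>Pow (addables M \<inter> L) - {{}}. tab_sum g L (M \<union> A))"
proof -
  define P where "P = Pow (addables M \<inter> L) - {{}}"
  define h where "h N T = (\<Prod>k\<in>{1..card (T ` (L - N))}. g (N \<union> {c \<in> L - N. T c < k}))" for N T
  have finP: "finite P" unfolding P_def using addables_finite[OF assms(2)] by simp
  have "(\<Sum>T\<in>inc_tabs L M. h M T) = (\<Sum>(A, T)\<in>Sigma P (\<lambda>A. inc_tabs L (M \<union> A)). g M * h (M \<union> A) T)"
  proof (rule sum.reindex_bij_witness[where
      i = "\<lambda>(A, T). raise (L - (M \<union> A)) A T" and j = "\<lambda>T. ({c \<in> L - M. T c = 1}, \<lambda>c. T c - 1)"])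
    fix T assume T: "T \<in> inc_tabs L M"
    define A where "A = {c \<in> L - M. T c = 1}"
    define U where "U = (\<lambda>c. T c - 1)"
    note f = first_entries[OF assms T, folded A_def, folded U_def]
    show "(case ({c \<in> L - M. T c = 1}, \<lambda>c. T c - 1) of (A, T) \<Rightarrow> raise (L - (M \<union> A)) A T) = T"
      using f(6) unfolding A_def U_def by simp
    show "({c \<in> L - M. T c = 1}, \<lambda>c. T c - 1) \<in> Sigma P (\<lambda>A. inc_tabs L (M \<union> A))"
      using f(1-4) unfolding A_def U_def P_def by blast
    \<comment> \<open>Threshold \<open>k + 1\<close> for \<open>T\<close> is threshold
      \<open>k\<close> for the lowered filling; the remaining threshold 1 yields the factor
      \<open>g M\<close>.\<close>
    have cells: "M \<union> {c \<in> L - M. T c < Suc k} = M \<union> A \<union> {c \<in> L - (M \<union> A). U c < k}"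
      if "1 \<le> k" for k
      using that inc_tabsD(2)[OF T] unfolding A_def U_def by fastforce
    have first: "M \<union> {c \<in> L - M. T c < 1} = M" using inc_tabsD(2)[OF T] by force
    let ?n = "card (U ` (L - (M \<union> A)))"
    have "h M T = (\<Prod>k\<in>{1..Suc ?n}. g (M \<union> {c \<in> L - M. T c < k}))"
      unfolding h_def f(5) ..
    also have "\<dots> = g (M \<union> {c \<in> L - M. T c < 1}) * (\<Prod>k\<in>{Suc 1..Suc ?n}. g (M \<union> {c \<in> L - M. T c < k}))"
      by (rule prod.atLeast_Suc_atMost) simp
    also have "g (M \<union> {c \<in> L - M. T c < 1}) = g M" unfolding first ..
    also have "(\<Prod>k\<in>{Suc 1..Suc ?n}. g (M \<union> {c \<in> L - M. T c < k})) =
        (\<Prod>k\<in>{1..?n}. g (M \<union> {c \<in> L - M. T c < Suc k}))"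
      by (rule prod.shift_bounds_cl_Suc_ivl)
    also have "\<dots> = h (M \<union> A) U"
      unfolding h_def
    proof (rule prod.cong[OF refl])
      fix k assume "k \<in> {1..?n}"
      then have "1 \<le> k" by simp
      then show "g (M \<union> {c \<in> L - M. T c < Suc k}) = g (M \<union> A \<union> {c \<in> L - (M \<union> A). U c < k})"
        by (simp only: cells)
    qed
    finally show "(case ({c \<in> L - M. T c = 1}, \<lambda>c. T c - 1) of (A, T) \<Rightarrow> g M * h (M \<union> A) T) = h M T"
      unfolding A_def U_def by simp
  next
    fix b assume b: "b \<in> Sigma P (\<lambda>A. inc_tabs L (M \<union> A))"
    obtain A T where AT: "b = (A, T)" by force
    have *: "A \<subseteq> addables M" "A \<subseteq> L" "A \<noteq> {}" "T \<in> inc_tabs L (M \<union> A)"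
      using b AT unfolding P_def by auto
    note r = raise_inc_tabs[OF assms(2) *(1-3) assms(1) *(4)]
    show "(case b of (A, T) \<Rightarrow> raise (L - (M \<union> A)) A T) \<in> inc_tabs L M" using r(1) AT by simp
    show "({c \<in> L - M. (case b of (A, T) \<Rightarrow> raise (L - (M \<union> A)) A T) c = 1},
        \<lambda>c. (case b of (A, T) \<Rightarrow> raise (L - (M \<union> A)) A T) c - 1) = b"
      using r(2,3) AT by simp
  qed
  also have "\<dots> = (\<Sum>A\<in>P. \<Sum>T\<in>inc_tabs L (M \<union> A). g M * h (M \<union> A) T)"
    using finP finite_inc_tabs[OF youngD(1)[OF assms(1)]] by (intro sum.Sigma[symmetric]) auto
  also have "\<dots> = g M * (\<Sum>A\<in>P. tab_sum g L (M \<union> A))"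
    unfolding tab_sum_def h_def sum_distrib_left ..
  finally show ?thesis unfolding tab_sum_def h_def P_def .
qed

text \<open>Moving the summand \<open>A = {}\<close> of the Chevalley formula to the other side
  gives the recursion of \<open>tab_sum_rec\<close>. The hypothesis on \<open>row_wt\<close>
  guarantees that no factor is the conventional value \<open>inverse 0 = 0\<close>.\<close>

theorem tab_sum_eq_exc_sum:
  fixes z :: "int \<Rightarrow> 'a::field"
  assumes "young L" "young M" "M \<subseteq> L" "\<And>i j. (i, j) \<in> L \<Longrightarrow> i \<le> d" "\<And>p. z p \<noteq> 0"
    and "\<And>N. young N \<Longrightarrow> N \<subset> L \<Longrightarrow> row_wt d z N \<noteq> row_wt d z L"
    and "exc_sum L z L \<noteq> 0"
  shows "tab_sum (\<lambda>N. inverse (row_wt d z N / row_wt d z L - 1)) L M = exc_sum L z M / exc_sum L z L"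
    (is "tab_sum ?g L M = _")
  using assms(2,3)
proof (induction "card (L - M)" arbitrary: M rule: less_induct)
  case less
  have finL: "finite L" using youngD(1)[OF assms(1)] .
  have W: "row_wt d z L \<noteq> 0" unfolding row_wt_def using assms(5) by simp
  show ?case
  proof (cases "M = L")
    case True
    then show ?thesis using tab_sum_self assms(7) by simp
  next
    case False
    let ?P = "Pow (addables M \<inter> L) - {{}}"
    have fin: "finite (addables M)" using addables_finite[OF less(2)] .
    have IH: "tab_sum ?g L (M \<union> A) = exc_sum L z (M \<union> A) / exc_sum L z L" if A: "A \<in> ?P" for A
    proof (rule less(1))
      obtain c where "c \<in> A" using A by blast
      then have "c \<in> L - M" "c \<notin> L - (M \<union> A)" using A unfolding addables_def by auto
      then have "L - (M \<union> A) \<subset> L - M" by blast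
      then show "card (L - (M \<union> A)) < card (L - M)" using finL by (intro psubset_card_mono) auto
      show "young (M \<union> A)" using young_Un_addables[OF less(2)] A by blast
      show "M \<union> A \<subseteq> L" using less(3) A by blast
    qed
    \<comment> \<open>Sets with corners outside \<open>L\<close> may be included, since their
      summands vanish.\<close>
    have "(\<Sum>A\<in>?P. exc_sum L z (M \<union> A)) = (\<Sum>A\<in>Pow (addables M) - {{}}. exc_sum L z (M \<union> A))"
      using fin by (intro sum.mono_neutral_left) (auto intro!: exc_sum_eq_0)
    also have "\<dots> = (\<Sum>A\<in>Pow (addables M). exc_sum L z (M \<union> A)) - exc_sum L z M"
      using fin by (subst sum_diff1) auto
    also have "\<dots> = (row_wt d z M / row_wt d z L - 1) * exc_sum L z M"
      using chevalley[OF assms(1) less(2) assms(4,5)] W by (simp add: field_simps)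
    finally have "(\<Sum>A\<in>?P. exc_sum L z (M \<union> A)) = (row_wt d z M / row_wt d z L - 1) * exc_sum L z M" .
    moreover have "row_wt d z M / row_wt d z L - 1 \<noteq> 0"
      using assms(6)[OF less(2)] less(3) False W by (simp add: psubset_eq)
    moreover have "tab_sum ?g L M = ?g M * (\<Sum>A\<in>?P. exc_sum L z (M \<union> A) / exc_sum L z L)"
      unfolding tab_sum_rec[OF assms(1) less(2,3) False] by (simp only: sum.cong[OF refl IH])
    ultimately show ?thesis by (simp add: sum_divide_distrib[symmetric])
  qed
qed

section \<open>Partitions and the specialisation of the parameters\<close>

lemma partition_antimono:
  assumes "is_partition lam" "1 \<le> i" "i \<le> i'"
  shows "lam i' \<le> lam i"
  using assms(3,2)
proof (induction rule: dec_induct)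
  case (step n)
  then show ?case using assms(1) unfolding is_partition_def by (meson le_trans)
qed simp

lemma young_diagram:
  assumes "is_partition lam" shows "young (diagram lam)"
proof (rule youngI)
  have "diagram lam \<subseteq> Sigma {i. i \<ge> 1 \<and> lam i \<noteq> 0} (\<lambda>i. {1..lam i})"
    unfolding diagram_def by auto
  then show "finite (diagram lam)"
    using assms unfolding is_partition_def by (meson finite_SigmaI finite_atLeastAtMost finite_subset)
  show "1 \<le> i \<and> 1 \<le> j" if "(i, j) \<in> diagram lam" for i j
    using that unfolding diagram_def by simp
  show "(i', j') \<in> diagram lam"
    if "(i, j) \<in> diagram lam" "1 \<le> i'" "i' \<le> i" "1 \<le> j'" "j' \<le> j" for i j i' j'
    using that partition_antimono[OF assms that(2,3)] unfolding diagram_def by simp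
qed

lemma row_len_diagram:
  assumes "1 \<le> i" shows "row_len (diagram lam) i = lam i"
proof -
  have "{j. (i, j) \<in> diagram lam} = {1..lam i}" using assms unfolding diagram_def by auto
  then show ?thesis unfolding row_len_def by simp
qed

lemma col_len_diagram:
  assumes "1 \<le> j" shows "col_len (diagram lam) j = conj_part lam j"
  using assms unfolding col_len_def conj_part_def diagram_def by simp

lemma hook_eq:
  assumes "(i, j) \<in> diagram lam"
  shows "hook lam (i, j) = row_pos (diagram lam) i - col_pos (diagram lam) j"
  using assms row_len_diagram[of i lam] col_len_diagram[of j lam]
  unfolding hook_def row_pos_def col_pos_def diagram_def by simp

lemma hook_pos:
  assumes "is_partition lam" "(i, j) \<in> diagram lam"
  shows "0 < hook lam (i, j)"
proof -
  note y = young_diagram[OF assms(1)]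
  have p: "1 \<le> i" "1 \<le> j" using assms(2) unfolding diagram_def by auto
  then have "j \<le> row_len (diagram lam) i" "i \<le> col_len (diagram lam) j"
    using mem_iff_row[OF y p(1), of j] mem_iff_col[OF y p(2), of i] assms(2) by auto
  then show ?thesis unfolding hook_eq[OF assms(2)] row_pos_def col_pos_def by linarith
qed

lemma excited_eq_exc:
  assumes "diagram mu \<subseteq> diagram lam"
  shows "excited lam mu = exc (diagram lam) (diagram mu)"
proof
  have act: "active lam S (i, j) \<longleftrightarrow> act (diagram lam) S i j" for S i j
    unfolding active_def act_def by simp
  show "excited lam mu \<subseteq> exc (diagram lam) (diagram mu)"
  proof
    fix S assume "S \<in> excited lam mu"
    then show "S \<in> exc (diagram lam) (diagram mu)"
    proof induction
      case base show ?case using assms by (rule exc.start)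
    next
      case (move1 S i j) then show ?case unfolding act by (intro exc.slide)
    next
      case (move2 S i j) then show ?case unfolding act by (intro exc.grow)
    qed
  qed
  show "exc (diagram lam) (diagram mu) \<subseteq> excited lam mu"
  proof
    fix S assume "S \<in> exc (diagram lam) (diagram mu)"
    then show "S \<in> excited lam mu"
    proof induction
      case start show ?case by (rule excited.base)
    next
      case (slide S i j) then show ?case unfolding act[symmetric] by (intro excited.move1)
    next
      case (grow S i j) then show ?case unfolding act[symmetric] by (intro excited.move2)
    qed
  qed
qed

lemma SIT_eq_inc_tabs: "SIT lam mu = inc_tabs (diagram lam) (diagram mu)"
  unfolding SIT_def inc_tabs_def skew_def ..

section \<open>The specialised parameters as rational functions\<close>

definition param :: "nat \<Rightarrow> int \<Rightarrow> ratfun" where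
  "param d p = 1 + beta * of_int (p + int d + 1)"

lemma of_int_ratfun: "(of_int n :: ratfun) = Fract (of_int n) 1"
proof -
  have nat: "(of_nat n :: ratfun) = Fract (of_nat n) 1" for n
    by (rule of_nat_fract)
  show ?thesis by (cases n rule: int_cases2) (simp_all add: nat)
qed

lemma param_Fract: "param d p = Fract [:1, of_int (p + int d + 1):] 1"
  unfolding param_def beta_def of_int_ratfun One_fract_def by (simp add: of_int_poly one_pCons)

lemma param_nonzero: "param d p \<noteq> 0"
  unfolding param_Fract Zero_fract_def by (simp add: eq_fract)

lemma beta_nonzero: "beta \<noteq> 0"
  unfolding beta_def Zero_fract_def by (simp add: eq_fract)

lemma of_int_ratfun_nonzero: "n \<noteq> 0 \<Longrightarrow> (of_int n :: ratfun) \<noteq> 0"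
  unfolding of_int_ratfun Zero_fract_def by (simp add: eq_fract)

lemma prod_Fract: "finite I \<Longrightarrow> (\<Prod>i\<in>I. Fract (f i) 1) = (Fract (\<Prod>i\<in>I. f i) 1 :: ratfun)"
  by (induction rule: finite_induct) (simp_all add: One_fract_def)

text \<open>Evaluating at \<open>beta = 1\<close> suffices: there all factors are positive, none
  decreases from \<open>N\<close> to \<open>L\<close>, and a row that gains a cell has a strictly
  larger factor.\<close>

lemma row_wt_param_neq:
  assumes "young L" "young N" "N \<subset> L" "\<And>i j. (i, j) \<in> L \<Longrightarrow> i \<le> d"
  shows "row_wt d (param d) N \<noteq> row_wt d (param d) L"
proof
  assume eq: "row_wt d (param d) N = row_wt d (param d) L"
  define v :: "(nat \<times> nat) set \<Rightarrow> nat \<Rightarrow> rat" where "v K i = 1 + of_int (row_pos K i + int d + 1)" for K i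
  have wt: "row_wt d (param d) K = Fract (\<Prod>i\<in>{1..d}. [:1, of_int (row_pos K i + int d + 1):]) 1" for K
    unfolding row_wt_def param_Fract by (rule prod_Fract) simp
  have "(\<Prod>i\<in>{1..d}. [:1, of_int (row_pos N i + int d + 1):]) =
      (\<Prod>i\<in>{1..d}. [:1, of_int (row_pos L i + int d + 1):] :: rat poly)"
    using eq unfolding wt by (simp add: eq_fract)
  then have "poly (\<Prod>i\<in>{1..d}. [:1, of_int (row_pos N i + int d + 1):]) 1 =
      poly (\<Prod>i\<in>{1..d}. [:1, of_int (row_pos L i + int d + 1):] :: rat poly) 1" by (rule arg_cong)
  then have "(\<Prod>i\<in>{1..d}. v N i) = (\<Prod>i\<in>{1..d}. v L i)"
    unfolding v_def poly_prod by simp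
  moreover have "(\<Prod>i\<in>{1..d}. v N i) < (\<Prod>i\<in>{1..d}. v L i)"
  proof -
    have pos: "0 < v K i" if "i \<in> {1..d}" for K i
      using that unfolding v_def row_pos_def by (simp add: of_int_pos[unfolded of_int_add] add_pos_nonneg)
    have le: "row_len N i \<le> row_len L i" for i
      unfolding row_len_def using assms(3) finite_line[OF assms(1)] by (intro card_mono) auto
    obtain i j where ij: "(i, j) \<in> L" "(i, j) \<notin> N" using assms(3) by auto
    have i: "1 \<le> i" "1 \<le> j" "i \<le> d" using youngD(2,3)[OF assms(1) ij(1)] assms(4)[OF ij(1)] by auto
    have "row_len N i < row_len L i"
      using mem_iff_row[OF assms(1) i(1), of j] mem_iff_row[OF assms(2) i(1), of j] ij i by linarith
    then have lt: "v N i < v L i" unfolding v_def row_pos_def by simp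
    have mono: "v N k \<le> v L k" for k using le[of k] unfolding v_def row_pos_def by simp
    show ?thesis
      using i lt mono pos by (intro prod_mono_strict[of i]) (auto intro: less_imp_le)
  qed
  ultimately show False by simp
qed

text \<open>The parameters are affine in the position, so the difference of the column and row
  parameters is \<open>- beta\<close> times the hook length. The reciprocal form matches the factors
  over the complement of \<open>D\<close>.\<close>

lemma cell_wt_param:
  assumes "is_partition lam" "c \<in> diagram lam" "\<forall>i>d. lam i = 0"
  shows "cell_wt (diagram lam) (param d) c =
      inverse (inverse (- beta) * ((beta * of_nat (lam (fst c) + (d - fst c) + 1) + 1) / of_int (hook lam c)))"
    and "cell_wt (diagram lam) (param d) c \<noteq> 0"
proof -
  obtain i j where ij: "c = (i, j)" by force
  have i: "1 \<le> i" "1 \<le> j" "j \<le> lam i" using assms(2) ij unfolding diagram_def by auto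
  \<comment> \<open>This makes the natural-number subtraction \<open>d - i\<close> exact.\<close>
  have id: "i \<le> d" using assms(3) i by (metis not_le le_0_eq not_one_le_zero)
  let ?a = "row_pos (diagram lam) i" and ?b = "col_pos (diagram lam) j"
  have h: "hook lam c = ?a - ?b" "hook lam c \<noteq> 0"
    using hook_eq[of i j lam] hook_pos[OF assms(1), of i j] assms(2) ij by auto
  have "int (lam i + (d - i) + 1) = ?a + int d + 1"
    using row_len_diagram[OF i(1), of lam] id unfolding row_pos_def by simp
  then have "(of_nat (lam i + (d - i) + 1) :: ratfun) = of_int (?a + int d + 1)"
    by (metis of_int_of_nat_eq)
  then have A: "beta * of_nat (lam i + (d - i) + 1) + 1 = param d ?a" unfolding param_def by simp
  have "cell_wt (diagram lam) (param d) c = (param d ?b - param d ?a) / param d ?a"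
    unfolding cell_wt_def ij using param_nonzero[of d ?a] by (simp add: diff_divide_distrib)
  also have "param d ?b - param d ?a = - beta * of_int (hook lam c)"
    unfolding param_def h(1) by (simp add: algebra_simps)
  finally have w: "cell_wt (diagram lam) (param d) c = - beta * of_int (hook lam c) / param d ?a" .
  show "cell_wt (diagram lam) (param d) c \<noteq> 0"
    unfolding w using param_nonzero[of d ?a] beta_nonzero of_int_ratfun_nonzero[OF h(2)] by simp
  show "cell_wt (diagram lam) (param d) c =
      inverse (inverse (- beta) * ((beta * of_nat (lam (fst c) + (d - fst c) + 1) + 1) / of_int (hook lam c)))"
    unfolding w using A ij by (simp add: field_simps)
qed

theorem theorem1p4:
  fixes d :: nat and lam mu :: "nat \<Rightarrow> nat"
  assumes "d \<ge> 1"
    and "is_partition lam" and "is_partition mu"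
    and "\<forall>i\<ge>1. mu i \<le> lam i"
    and "\<forall>i>d. lam i = 0"
  shows "(\<Sum>T\<in>SIT lam mu. \<Prod>k\<in>{1..sit_m lam mu T}.
            inverse ((\<Prod>i\<in>{1..d}. (1 + beta * of_nat (nu_part lam mu T k i + (d - i) + 1))
                                    / (1 + beta * of_nat (lam i + (d - i) + 1))) - 1))
       = (\<Sum>D\<in>excited lam mu.
            (- beta) powi (int (card D) - int (card (diagram lam)))
            * (\<Prod>c\<in>diagram lam - D.
                 (beta * of_nat (lam (fst c) + (d - fst c) + 1) + 1) / of_int (hook lam c)))"
proof -
  let ?L = "diagram lam" and ?M = "diagram mu" and ?z = "param d"
  let ?w = "cell_wt ?L ?z"
  let ?q = "\<lambda>c. (beta * of_nat (lam (fst c) + (d - fst c) + 1) + 1) / of_int (hook lam c)"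
  have yL: "young ?L" and yM: "young ?M" using young_diagram assms(2,3) by auto
  have sub: "?M \<subseteq> ?L" using assms(4) unfolding diagram_def by fastforce
  have rows: "i \<le> d" if "(i, j) \<in> ?L" for i j
    using that assms(5) unfolding diagram_def by (auto, metis not_le le_0_eq not_one_le_zero One_nat_def)
  have finL: "finite ?L" using youngD(1)[OF yL] .
  have nz: "(\<Prod>c\<in>X. ?w c) \<noteq> 0" if "X \<subseteq> ?L" for X
    using cell_wt_param(2)[OF assms(2) _ assms(5)] that finite_subset[OF that finL] by (auto simp: prod_zero_iff)
  have exc_L: "exc_sum ?L ?z ?L = (\<Prod>c\<in>?L. ?w c)" unfolding exc_sum_def exc_self by simp
  have pos: "1 + beta * of_nat (row_len K i + (d - i) + 1) = ?z (row_pos K i)" if "i \<in> {1..d}" for K i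
  proof -
    have "int (row_len K i + (d - i) + 1) = row_pos K i + int d + 1" using that unfolding row_pos_def by simp
    then have "(of_nat (row_len K i + (d - i) + 1) :: ratfun) = of_int (row_pos K i + int d + 1)"
      by (metis of_int_of_nat_eq)
    then show ?thesis unfolding param_def by simp
  qed
  have "(\<Prod>i\<in>{1..d}. (1 + beta * of_nat (nu_part lam mu T k i + (d - i) + 1))
        / (1 + beta * of_nat (lam i + (d - i) + 1)))
      = row_wt d ?z (?M \<union> {c \<in> ?L - ?M. T c < k}) / row_wt d ?z ?L" for T k
    unfolding row_wt_def prod_dividef[symmetric]
  proof (rule prod.cong[OF refl])
    fix i assume i: "i \<in> {1..d}"
    have "nu_part lam mu T k i = row_len (?M \<union> {c \<in> ?L - ?M. T c < k}) i"
      unfolding nu_part_def row_len_def skew_def ..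
    moreover have "lam i = row_len ?L i" using row_len_diagram[of i lam] i by simp
    ultimately show "(1 + beta * of_nat (nu_part lam mu T k i + (d - i) + 1))
        / (1 + beta * of_nat (lam i + (d - i) + 1))
      = ?z (row_pos (?M \<union> {c \<in> ?L - ?M. T c < k}) i) / ?z (row_pos ?L i)"
      by (simp only: pos[OF i])
  qed
  then have "(\<Sum>T\<in>SIT lam mu. \<Prod>k\<in>{1..sit_m lam mu T}.
            inverse ((\<Prod>i\<in>{1..d}. (1 + beta * of_nat (nu_part lam mu T k i + (d - i) + 1))
                                    / (1 + beta * of_nat (lam i + (d - i) + 1))) - 1))
      = tab_sum (\<lambda>N. inverse (row_wt d ?z N / row_wt d ?z ?L - 1)) ?L ?M"
    unfolding tab_sum_def SIT_eq_inc_tabs sit_m_def skew_def by simp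
  also have "\<dots> = exc_sum ?L ?z ?M / exc_sum ?L ?z ?L"
    using row_wt_param_neq[OF yL _ _ rows] nz[of ?L] param_nonzero rows
    by (intro tab_sum_eq_exc_sum[OF yL yM sub]) (auto simp: exc_L)
  also have "\<dots> = (\<Sum>D\<in>exc ?L ?M. (- beta) powi (int (card D) - int (card ?L)) * (\<Prod>c\<in>?L - D. ?q c))"
    unfolding exc_L unfolding exc_sum_def sum_divide_distrib
  proof (rule sum.cong[OF refl])
    fix D assume "D \<in> exc ?L ?M"
    then have D: "D \<subseteq> ?L" using exc_subset by blast
    \<comment> \<open>The exponent is minus the size of the complement, so the power spreads as one
      factor \<open>inverse (- beta)\<close> over each cell outside \<open>D\<close>.\<close>
    have "int (card D) - int (card ?L) = - int (card (?L - D))"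
      using D finL by (simp add: card_Diff_subset finite_subset card_mono of_nat_diff)
    then have "(- beta) powi (int (card D) - int (card ?L)) = (\<Prod>c\<in>?L - D. inverse (- beta))"
      by (simp only: power_int_minus power_int_of_nat prod_constant power_inverse)
    then have "(- beta) powi (int (card D) - int (card ?L)) * (\<Prod>c\<in>?L - D. ?q c)
        = (\<Prod>c\<in>?L - D. inverse (- beta) * ?q c)"
      by (simp only: prod.distrib)
    also have "\<dots> = (\<Prod>c\<in>?L - D. inverse (?w c))"
      using cell_wt_param(1)[OF assms(2) _ assms(5)] by (intro prod.cong) auto
    also have "\<dots> = inverse (\<Prod>c\<in>?L - D. ?w c)" using prod_inversef[of ?w] by (simp add: comp_def)
    also have "\<dots> = (\<Prod>c\<in>D. ?w c) / (\<Prod>c\<in>?L. ?w c)"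
      using prod.subset_diff[OF D finL, of ?w] nz[OF D] nz[of "?L - D"] by (simp add: field_simps)
    finally show "(\<Prod>c\<in>D. ?w c) / (\<Prod>c\<in>?L. ?w c) =
        (- beta) powi (int (card D) - int (card ?L)) * (\<Prod>c\<in>?L - D. ?q c)" ..
  qed
  finally show ?thesis unfolding excited_eq_exc[OF sub] .
qed

end
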